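(* Let $\{\xi_{\mathbf i}:\mathbf i\in\mathbb Z^q\}$ be a strictly stationary, $\varphi$-mixing random field with values in $\mathbb R^p$, with $\mathbb E(\xi_{\mathbf 0})=\mathbf 0$, $\max_{1\le j\le p}\mathbb E\big(\xi_{\mathbf 0}^{(j)}\big)^4<\infty$, and mixing coefficients satisfying $\sum_{r=1}^\infty r^{q-1}\varphi^{1/2}(r)<\infty$. Let the weights satisfy $w_{\mathbf m}(\mathbf j)\to1$ as $\mathbf m\to\infty$ for all $\mathbf j\in\mathbb Z^q$ and $|w_{\mathbf m}(\mathbf j)|\le C_w<\infty$ with $C_w$ independent of $\mathbf j,\mathbf m$. Let $\mathbf m=\mathbf m_{\mathbf n}\in\mathbb N^q$ satisfy $\mathbf m\to\infty$ as $\mathbf n\to\infty$ and $(m^\star)^3/n_\star=o(1)$, where $m^\star=\max_im_i$, $n_\star=\min_in_i$. Let $g:\mathbb R\times[0,\infty)\to[0,1]$ be a (bounded) function, extended to matrices entrywise by $g(A,c)=(g(a_{\nu\mu},c))_{1\le\nu,\mu\le p}$ for $A=(a_{\nu\mu})\in\mathbb R^{p\times p}$, $c\ge0$, and let $c_{\mathbf n}(\mathbf j)$ be thresholds such that, for every $\mathbf j\in\mathbb Z^q$ and all $1\le\nu,\mu\le p$, $\mathbb E\big(g((\widehat\gamma_{\mathbf n}(\mathbf j))_{\nu\mu},c_{\mathbf n}(\mathbf j))\big)\to1$ as $\mathbf n\to\infty$. Then the thresholding estimator $$\widehat\sigma_{\mathbf n,th}^2=\sum_{|\mathbf j|\le\mathbf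 m}w_{\mathbf m}(\mathbf j)\,\widehat\gamma_{\mathbf n}(\mathbf j)\circ g\big(\widehat\gamma_{\mathbf n}(\mathbf j),c_{\mathbf n}(\mathbf j)\big)$$ is weakly consistent for $\sigma^2$, i.e. $\|\widehat\sigma_{\mathbf n,th}^2-\sigma^2\|_\infty\to0$ in probability as $\mathbf n\to\infty$.
   Context: Fix integers $p,q\ge1$. For $\mathbf n=(n_1,\dots,n_q)\in\mathbb N^q$, $\mathbf n\to\infty$ means $\min_i n_i\to\infty$ (likewise for $\mathbf m$). $|\mathbf n|=\prod_i n_i$, $\Gamma_{\mathbf n}=\{1,\dots,n_1\}\times\dots\times\{1,\dots,n_q\}$. For $\mathbf j\in\mathbb Z^q$, $|\mathbf j|\le\mathbf m$ means $|j_i|\le m_i$ for all $i$. $\xi_{\mathbf i}=(\xi_{\mathbf i}^{(1)},\dots,\xi_{\mathbf i}^{(p)})'$ are column vectors, $'$ is transposition. $\|A\|_\infty=\max_{i,j}|a_{ij}|$ for a matrix $A$; $\circ$ is the Hadamard (entrywise) product. Mixing: for $1\le j\le q$ and $r\ge0$ let $\mathcal A^+(j;r)=\sigma(\xi_{\mathbf n}:n_j\ge r,\ n_i \text{ unrestricted for } i\ne j)$ and $\mathcal A^-(j;r)=\sigma(\xi_{\mathbf n}:n_j\le r,\ n_i\text{ unrestricted for } i\neq j)$. For $r\ge1$ let $\varphi(j;r)=\sup\{|\mathbb P(B|A)-\mathbb P(B)|:A\in\mathcal A^-(j;0),B\in\mathcal A^+(j;r),\mathbb P(A)>0\}$, $\varphi(r)=\max_{1\le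 j\le q}\varphi(j;r)$, and $\varphi(0)=1$. The field is $\varphi$-mixing if $\varphi(r)\to0$ as $r\to\infty$. $\widehat\gamma_{\mathbf n}(\mathbf j)=|\widetilde\Gamma_{\mathbf n}(\mathbf j)|^{-1}\sum_{\mathbf i\in\widetilde\Gamma_{\mathbf n}(\mathbf j)}\xi_{\mathbf i}\xi_{\mathbf i+\mathbf j}'$, where $\widetilde\Gamma_{\mathbf n}(\mathbf j)=\{\mathbf i\in\Gamma_{\mathbf n}:\mathbf i+\mathbf j\in\Gamma_{\mathbf n}\}$. The asymptotic variance is $\sigma^2=\sum_{\mathbf k\in\mathbb Z^q}\mathbb E(\xi_{\mathbf 0}\xi_{\mathbf k}')=\lim_{\mathbf n\to\infty}|\mathbf n|^{-1}\mathbb E(S_{\mathbf n}S_{\mathbf n}')$ with $S_{\mathbf n}=\sum_{\mathbf i\in\Gamma_{\mathbf n}}\xi_{\mathbf i}$. The weights $w_{\mathbf m}(\mathbf j)$ are real numbers; $g$ is measurable. *)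

theory Defs
  imports "HOL-Probability.Probability"
begin

definition vmin :: "nat ^ 'q \<Rightarrow> nat" where
  "vmin n = Min (range (\<lambda>k. n $ k))"

definition vmax :: "nat ^ 'q \<Rightarrow> nat" where
  "vmax n = Max (range (\<lambda>k. n $ k))"

definition to_infinity :: "(nat ^ 'q) filter" where
  "to_infinity = filtercomap vmin at_top"

definition Gam :: "nat ^ 'q \<Rightarrow> (int ^ 'q) set" where
  "Gam n = {i. \<forall>k. 1 \<le> i $ k \<and> i $ k \<le> int (n $ k)}"

definition Gam_lag :: "nat ^ 'q \<Rightarrow> int ^ 'q \<Rightarrow> (int ^ 'q) set" where
  "Gam_lag n j = {i \<in> Gam n. i + j \<in> Gam n}"

definition lag_box :: "nat ^ 'q \<Rightarrow> (int ^ 'q) set" where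
  "lag_box m = {j. \<forall>k. \<bar>j $ k\<bar> \<le> int (m $ k)}"

definition outer :: "real ^ 'p \<Rightarrow> real ^ 'p \<Rightarrow> real ^ 'p ^ 'p" where
  "outer x y = (\<chi> \<nu> \<mu>. x $ \<nu> * y $ \<mu>)"

definition hadamard :: "real ^ 'p ^ 'p \<Rightarrow> real ^ 'p ^ 'p \<Rightarrow> real ^ 'p ^ 'p"  (infixl "\<circ>\<^sub>H" 70) where
  "A \<circ>\<^sub>H B = (\<chi> \<nu> \<mu>. A $ \<nu> $ \<mu> * B $ \<nu> $ \<mu>)"

definition max_norm :: "real ^ 'p ^ 'p \<Rightarrow> real" where
  "max_norm A = Max {\<bar>A $ \<nu> $ \<mu>\<bar> | \<nu> \<mu>. True}"

definition entrywise :: "(real \<Rightarrow> real \<Rightarrow> real) \<Rightarrow> real ^ 'p ^ 'p \<Rightarrow> real \<Rightarrow> real ^ 'p ^ 'p" where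
  "entrywise g A c = (\<chi> \<nu> \<mu>. g (A $ \<nu> $ \<mu>) c)"

definition strictly_stationary ::
  "'w measure \<Rightarrow> (int ^ 'q \<Rightarrow> 'w \<Rightarrow> real ^ 'p) \<Rightarrow> bool" where
  "strictly_stationary M \<xi> \<longleftrightarrow>
     (\<forall>I h. finite I \<longrightarrow>
        distr M (Pi\<^sub>M I (\<lambda>_. borel)) (\<lambda>\<omega>. \<lambda>i\<in>I. \<xi> (i + h) \<omega>)
      = distr M (Pi\<^sub>M I (\<lambda>_. borel)) (\<lambda>\<omega>. \<lambda>i\<in>I. \<xi> i \<omega>))"

definition field_sigma ::
  "'w measure \<Rightarrow> (int ^ 'q \<Rightarrow> 'w \<Rightarrow> real ^ 'p) \<Rightarrow> (int ^ 'q) set \<Rightarrow> 'w set set" where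
  "field_sigma M \<xi> I =
     sigma_sets (space M) {\<xi> i -` B \<inter> space M | i B. i \<in> I \<and> B \<in> sets borel}"

definition sigma_plus ::
  "'w measure \<Rightarrow> (int ^ 'q \<Rightarrow> 'w \<Rightarrow> real ^ 'p) \<Rightarrow> 'q \<Rightarrow> nat \<Rightarrow> 'w set set" where
  "sigma_plus M \<xi> j r = field_sigma M \<xi> {n. n $ j \<ge> int r}"

definition sigma_minus ::
  "'w measure \<Rightarrow> (int ^ 'q \<Rightarrow> 'w \<Rightarrow> real ^ 'p) \<Rightarrow> 'q \<Rightarrow> nat \<Rightarrow> 'w set set" where
  "sigma_minus M \<xi> j r = field_sigma M \<xi> {n. n $ j \<le> int r}"

definition phi_dir ::
  "'w measure \<Rightarrow> (int ^ 'q \<Rightarrow> 'w \<Rightarrow> real ^ 'p) \<Rightarrow> 'q \<Rightarrow> nat \<Rightarrow> real" where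
  "phi_dir M \<xi> j r =
     Sup {\<bar>\<P>(\<omega> in M. \<omega> \<in> B \<bar> \<omega> \<in> A) - measure M B\<bar> | A B.
          A \<in> sigma_minus M \<xi> j 0 \<and> B \<in> sigma_plus M \<xi> j r \<and> measure M A > 0}"

definition phi ::
  "'w measure \<Rightarrow> (int ^ 'q \<Rightarrow> 'w \<Rightarrow> real ^ 'p) \<Rightarrow> nat \<Rightarrow> real" where
  "phi M \<xi> r = (if r = 0 then 1 else Max (range (\<lambda>j. phi_dir M \<xi> j r)))"

definition phi_mixing ::
  "'w measure \<Rightarrow> (int ^ 'q \<Rightarrow> 'w \<Rightarrow> real ^ 'p) \<Rightarrow> bool" where
  "phi_mixing M \<xi> \<longleftrightarrow> phi M \<xi> \<longlonglongrightarrow> 0"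

text \<open>If no pair of sites at lag \<open>j\<close> lies in the observation window, the value is \<open>0\<close>.\<close>

definition gamma_hat ::
  "(int ^ 'q \<Rightarrow> 'w \<Rightarrow> real ^ 'p) \<Rightarrow> nat ^ 'q \<Rightarrow> int ^ 'q \<Rightarrow> 'w \<Rightarrow> real ^ 'p ^ 'p" where
  "gamma_hat \<xi> n j \<omega> =
     (1 / real (card (Gam_lag n j))) *\<^sub>R (\<Sum>i\<in>Gam_lag n j. outer (\<xi> i \<omega>) (\<xi> (i + j) \<omega>))"

text \<open>Under the moment and mixing hypotheses of the theorem this series converges absolutely,
  so the default value of \<open>infsum\<close> for divergent series plays no role.\<close>

definition asym_var ::
  "'w measure \<Rightarrow> (int ^ 'q \<Rightarrow> 'w \<Rightarrow> real ^ 'p) \<Rightarrow> real ^ 'p ^ 'p" where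
  "asym_var M \<xi> = (\<Sum>\<^sub>\<infinity>k\<in>UNIV. \<integral>\<omega>. outer (\<xi> 0 \<omega>) (\<xi> k \<omega>) \<partial>M)"

definition sigma_hat_th ::
  "(int ^ 'q \<Rightarrow> 'w \<Rightarrow> real ^ 'p) \<Rightarrow> (nat ^ 'q \<Rightarrow> int ^ 'q \<Rightarrow> real) \<Rightarrow> (nat ^ 'q \<Rightarrow> nat ^ 'q) \<Rightarrow>
   (real \<Rightarrow> real \<Rightarrow> real) \<Rightarrow> (nat ^ 'q \<Rightarrow> int ^ 'q \<Rightarrow> real) \<Rightarrow> nat ^ 'q \<Rightarrow> 'w \<Rightarrow> real ^ 'p ^ 'p" where
  "sigma_hat_th \<xi> w m g c n \<omega> =
     (\<Sum>j\<in>lag_box (m n).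
        w (m n) j *\<^sub>R (gamma_hat \<xi> n j \<omega> \<circ>\<^sub>H entrywise g (gamma_hat \<xi> n j \<omega>) (c n j)))"

definition tends_to_zero_in_prob ::
  "'w measure \<Rightarrow> ('i \<Rightarrow> 'w \<Rightarrow> real) \<Rightarrow> 'i filter \<Rightarrow> bool" where
  "tends_to_zero_in_prob M X F \<longleftrightarrow>
     (\<forall>\<epsilon>>0. ((\<lambda>n. \<P>(\<omega> in M. \<bar>X n \<omega>\<bar> > \<epsilon>)) \<longlongrightarrow> 0) F)"

end

theory Submission
  imports Defs
begin

text \<open>The thresholded estimator converges to \<open>\<sigma>\<^sup>2\<close> even in mean, entry by entry, and convergence in
  probability follows from Markov's inequality. Fix an entry, let \<open>\<gamma> j\<close> be the autocovariance at
  lag \<open>j\<close>, \<open>h j\<close> its estimator, \<open>W j\<close> the weight and \<open>U j\<close> the threshold factor. Then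
  \<open>\<Sum> W j h j U j - \<Sum> \<gamma> j\<close> splits into \<open>\<Sum> W j U j (h j - \<gamma> j)\<close> and \<open>\<Sum> W j U j \<gamma> j - \<Sum> \<gamma> j\<close>.

  In the first part the factors \<open>W j U j\<close> are bounded, so it suffices that the sum of \<open>E \<bar>h j - \<gamma> j\<bar>\<close>
  over all lags in the box tends to zero. No cancellation between lags is required. With
  \<open>L\<close> the largest lag allowed and \<open>N\<close> the smallest side of the window, the mixing condition
  makes the mean square of \<open>h j - \<gamma> j\<close> at most a constant times \<open>(L / N)\<^bsup>q\<^esup>\<close>, because lag products
  at sites \<open>i\<close> and \<open>i'\<close> are nearly uncorrelated once \<open>i' - i\<close> is larger than \<open>L\<close>. Summing the roots of
  this over about \<open>L\<^bsup>q\<^esup>\<close> lags gives a multiple of the root of \<open>(L\<^sup>3 / N)\<^bsup>q\<^esup>\<close>, which vanishes by the growth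
  condition (\<open>gamma_hat_L1_bound\<close>, \<open>sum_L1_bound\<close>).

  In the second part the series of the \<open>\<gamma> j\<close> converges absolutely, again by mixing
  (\<open>autocov_summable\<close>), the factors \<open>W j U j\<close> are bounded and tend to 1 in mean for each lag
  \<open>j\<close>, and a dominated convergence argument applies (\<open>thresholded_entry_L1\<close>).

  Both uses of mixing rest on the covariance inequality \<open>covariance_le\<close>, which bounds the
  covariance of two square integrable variables across a gap \<open>r\<close> by a multiple of \<open>phi M \<xi> r\<close> to the
  power one half times the norms of the variables, and on a count of lattice points on spheres
  (\<open>lattice_sum_le\<close>), which matches the assumed series.\<close>

section \<open>The covariance inequality for \<open>\<phi>\<close>-mixing\<close>

text \<open>Lebesgue measure on the half-line, kept on the whole real type: the level sets of a
  nonnegative function are then plain predicates \<open>s < X \<omega>\<close>, and integrating their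
  indicators over this measure gives back \<open>X \<omega>\<close>.\<close>
definition half_lebesgue :: "real measure" where
  "half_lebesgue = density lborel (indicator {0..})"

lemma sets_half_lebesgue [measurable_cong, simp]: "sets half_lebesgue = sets borel"
  by (simp add: half_lebesgue_def)

lemma space_half_lebesgue [simp]: "space half_lebesgue = UNIV"
  by (simp add: half_lebesgue_def)

lemma sigma_finite_half_lebesgue: "sigma_finite_measure half_lebesgue"
  unfolding half_lebesgue_def
  by (subst sigma_finite_measure.sigma_finite_iff_density_finite[OF sigma_finite_lborel]) (auto simp: indicator_def)

lemma nn_integral_half_lebesgue:
  assumes "x \<ge> 0"
  shows "(\<integral>\<^sup>+s. indicator {..<x} s \<partial>half_lebesgue) = ennreal x"
proof -
  have "(\<integral>\<^sup>+s. indicator {..<x} s \<partial>half_lebesgue) = (\<integral>\<^sup>+s. indicator {0..<x} s \<partial>lborel)"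
    unfolding half_lebesgue_def
    by (subst nn_integral_density) (auto intro!: nn_integral_cong simp del: nn_integral_indicator split: split_indicator)
  with assms show ?thesis by simp
qed

text \<open>Fubini, used for four integrals below: products of random variables (\<open>\<omega>\<close> is the
  outcome), and products of functions of an auxiliary level \<open>u\<close> (\<open>\<omega>\<close> is that level).\<close>
lemma nn_integral_times_layers:
  assumes "sigma_finite_measure M" "sigma_finite_measure N"
    and P[measurable]: "Measurable.pred (M \<Otimes>\<^sub>M N) P" and Q[measurable]: "Measurable.pred (M \<Otimes>\<^sub>M N) Q"
  shows "(\<integral>\<^sup>+\<omega>. (\<integral>\<^sup>+s. indicator {s. P (\<omega>, s)} s \<partial>N) * (\<integral>\<^sup>+t. indicator {t. Q (\<omega>, t)} t \<partial>N) \<partial>M)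
       = (\<integral>\<^sup>+s. \<integral>\<^sup>+t. emeasure M {\<omega> \<in> space M. P (\<omega>, s) \<and> Q (\<omega>, t)} \<partial>N \<partial>N)"
proof -
  interpret M: sigma_finite_measure M by fact
  interpret N: sigma_finite_measure N by fact
  interpret MN: pair_sigma_finite M N ..
  have "(\<integral>\<^sup>+\<omega>. (\<integral>\<^sup>+s. indicator {s. P (\<omega>, s)} s \<partial>N) * (\<integral>\<^sup>+t. indicator {t. Q (\<omega>, t)} t \<partial>N) \<partial>M)
     = (\<integral>\<^sup>+\<omega>. \<integral>\<^sup>+s. (\<integral>\<^sup>+t. (if P (\<omega>, s) \<and> Q (\<omega>, t) then 1 else 0) \<partial>N) \<partial>N \<partial>M)"
  proof (intro nn_integral_cong)
    fix \<omega> assume [measurable, simp]: "\<omega> \<in> space M"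
    have "(\<integral>\<^sup>+s. indicator {s. P (\<omega>, s)} s \<partial>N) * (\<integral>\<^sup>+t. indicator {t. Q (\<omega>, t)} t \<partial>N)
        = (\<integral>\<^sup>+s. (if P (\<omega>, s) then 1 else 0) \<partial>N) * (\<integral>\<^sup>+t. (if Q (\<omega>, t) then 1 else 0) \<partial>N)"
      by (simp add: indicator_def of_bool_def)
    also have "\<dots> = (\<integral>\<^sup>+s. (if P (\<omega>, s) then 1 else 0) * (\<integral>\<^sup>+t. (if Q (\<omega>, t) then 1 else 0) \<partial>N) \<partial>N)"
      by (subst nn_integral_multc) auto
    also have "\<dots> = (\<integral>\<^sup>+s. (\<integral>\<^sup>+t. (if P (\<omega>, s) \<and> Q (\<omega>, t) then 1 else 0) \<partial>N) \<partial>N)"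
      by (intro nn_integral_cong) auto
    finally show "(\<integral>\<^sup>+s. indicator {s. P (\<omega>, s)} s \<partial>N) * (\<integral>\<^sup>+t. indicator {t. Q (\<omega>, t)} t \<partial>N)
        = (\<integral>\<^sup>+s. (\<integral>\<^sup>+t. (if P (\<omega>, s) \<and> Q (\<omega>, t) then 1 else 0) \<partial>N) \<partial>N)" .
  qed
  also have "\<dots> = (\<integral>\<^sup>+s. \<integral>\<^sup>+\<omega>. (\<integral>\<^sup>+t. (if P (\<omega>, s) \<and> Q (\<omega>, t) then 1 else 0) \<partial>N) \<partial>M \<partial>N)"
    by (subst MN.Fubini') auto
  also have "\<dots> = (\<integral>\<^sup>+s. \<integral>\<^sup>+t. (\<integral>\<^sup>+\<omega>. (if P (\<omega>, s) \<and> Q (\<omega>, t) then 1 else 0) \<partial>M) \<partial>N \<partial>N)"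
    by (intro nn_integral_cong, subst MN.Fubini') auto
  also have "\<dots> = (\<integral>\<^sup>+s. \<integral>\<^sup>+t. emeasure M {\<omega> \<in> space M. P (\<omega>, s) \<and> Q (\<omega>, t)} \<partial>N \<partial>N)"
    by (intro nn_integral_cong, subst nn_integral_indicator[symmetric])
       (auto intro!: nn_integral_cong simp: indicator_def simp del: nn_integral_indicator)
  finally show ?thesis .
qed

lemma nn_integral_layer_half_lebesgue: "x \<ge> 0 \<Longrightarrow> (\<integral>\<^sup>+s. indicator {s. s < x} s \<partial>half_lebesgue) = ennreal x"
  using nn_integral_half_lebesgue[of x] by (simp add: lessThan_def)

lemma emeasure_half_lebesgue: "x \<ge> 0 \<Longrightarrow> emeasure half_lebesgue {s. s < x} = ennreal x"
  using nn_integral_layer_half_lebesgue[of x] by simp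

lemma integrable_mult_of_squares:
  fixes X Y :: "'a \<Rightarrow> real"
  assumes [measurable]: "X \<in> borel_measurable M" "Y \<in> borel_measurable M"
    and sq: "integrable M (\<lambda>\<omega>. (X \<omega>)\<^sup>2)" "integrable M (\<lambda>\<omega>. (Y \<omega>)\<^sup>2)"
  shows "integrable M (\<lambda>\<omega>. X \<omega> * Y \<omega>)"
proof (rule Bochner_Integration.integrable_bound[OF Bochner_Integration.integrable_add[OF sq]])
  have "\<bar>x * y\<bar> \<le> x\<^sup>2 + y\<^sup>2" for x y :: real
  proof -
    have "2 * (\<bar>x\<bar> * \<bar>y\<bar>) \<le> x\<^sup>2 + y\<^sup>2" using sum_squares_bound[of "\<bar>x\<bar>" "\<bar>y\<bar>"] by simp
    moreover have "0 \<le> \<bar>x\<bar> * \<bar>y\<bar>" by simp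
    ultimately show ?thesis unfolding abs_mult by linarith
  qed
  then show "AE \<omega> in M. norm (X \<omega> * Y \<omega>) \<le> norm ((X \<omega>)\<^sup>2 + (Y \<omega>)\<^sup>2)"
    by simp
qed simp

context prob_space
begin

lemma tail_measurable [measurable]:
  assumes [measurable]: "X \<in> borel_measurable M"
  shows "(\<lambda>s::real. \<P>(\<omega> in M. s < X \<omega>)) \<in> borel_measurable borel"
proof -
  have "(\<lambda>s. - \<P>(\<omega> in M. s < X \<omega>)) \<in> borel_measurable borel"
    by (auto intro!: borel_measurable_mono monoI finite_measure_mono)
  then show ?thesis by (simp add: borel_measurable_uminus_eq)
qed

lemma nn_integral_layers:
  assumes [measurable]: "X \<in> borel_measurable M" and pos: "\<And>\<omega>. 0 \<le> X \<omega>"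
  shows "(\<integral>\<^sup>+\<omega>. ennreal (X \<omega>) \<partial>M) = (\<integral>\<^sup>+s. ennreal (\<P>(\<omega> in M. s < X \<omega>)) \<partial>half_lebesgue)"
proof -
  interpret N: sigma_finite_measure half_lebesgue by (rule sigma_finite_half_lebesgue)
  interpret pair_sigma_finite M half_lebesgue ..
  have "(\<integral>\<^sup>+\<omega>. ennreal (X \<omega>) \<partial>M) = (\<integral>\<^sup>+\<omega>. \<integral>\<^sup>+s. indicator {s. s < X \<omega>} s \<partial>half_lebesgue \<partial>M)"
    by (intro nn_integral_cong) (simp only: nn_integral_layer_half_lebesgue[OF pos])
  also have "\<dots> = (\<integral>\<^sup>+s. \<integral>\<^sup>+\<omega>. indicator {s. s < X \<omega>} s \<partial>M \<partial>half_lebesgue)"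
    by (rule Fubini'[symmetric]) (auto simp: indicator_def)
  also have "\<dots> = (\<integral>\<^sup>+s. \<integral>\<^sup>+\<omega>. indicator {\<omega> \<in> space M. s < X \<omega>} \<omega> \<partial>M \<partial>half_lebesgue)"
    by (intro nn_integral_cong) (auto simp: indicator_def)
  also have "\<dots> = (\<integral>\<^sup>+s. ennreal (\<P>(\<omega> in M. s < X \<omega>)) \<partial>half_lebesgue)"
    by (simp add: emeasure_eq_measure)
  finally show ?thesis .
qed

lemma nn_integral_product_layers:
  assumes [measurable]: "X \<in> borel_measurable M" "Y \<in> borel_measurable M"
    and pos: "\<And>\<omega>. 0 \<le> X \<omega>" "\<And>\<omega>. 0 \<le> Y \<omega>"
  shows "(\<integral>\<^sup>+\<omega>. ennreal (X \<omega> * Y \<omega>) \<partial>M)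
       = (\<integral>\<^sup>+s. \<integral>\<^sup>+t. ennreal (\<P>(\<omega> in M. s < X \<omega> \<and> t < Y \<omega>)) \<partial>half_lebesgue \<partial>half_lebesgue)"
  using nn_integral_times_layers[OF sigma_finite_measure_axioms sigma_finite_half_lebesgue,
      where P="\<lambda>(\<omega>, s). s < X \<omega>" and Q="\<lambda>(\<omega>, t). t < Y \<omega>"]
  by (simp add: nn_integral_layer_half_lebesgue pos ennreal_mult emeasure_eq_measure emeasure_half_lebesgue
      cong: nn_integral_cong)

lemma nn_integral_square_layers:
  assumes [measurable]: "X \<in> borel_measurable M" and pos: "\<And>\<omega>. 0 \<le> X \<omega>"
  shows "(\<integral>\<^sup>+\<omega>. ennreal ((X \<omega>)\<^sup>2) \<partial>M)
       = (\<integral>\<^sup>+s. \<integral>\<^sup>+t. ennreal (min (\<P>(\<omega> in M. s < X \<omega>)) (\<P>(\<omega> in M. t < X \<omega>))) \<partial>half_lebesgue \<partial>half_lebesgue)"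
proof -
  have "\<P>(\<omega> in M. s < X \<omega> \<and> t < X \<omega>) = min (\<P>(\<omega> in M. s < X \<omega>)) (\<P>(\<omega> in M. t < X \<omega>))" for s t
  proof (cases "s \<le> t")
    case True
    then have "\<P>(\<omega> in M. t < X \<omega>) \<le> \<P>(\<omega> in M. s < X \<omega>)" by (intro finite_measure_mono) auto
    moreover have "{\<omega> \<in> space M. s < X \<omega> \<and> t < X \<omega>} = {\<omega> \<in> space M. t < X \<omega>}"
      using True by auto
    ultimately show ?thesis by simp
  next
    case False
    then have "\<P>(\<omega> in M. s < X \<omega>) \<le> \<P>(\<omega> in M. t < X \<omega>)" by (intro finite_measure_mono) auto
    moreover have "{\<omega> \<in> space M. s < X \<omega> \<and> t < X \<omega>} = {\<omega> \<in> space M. s < X \<omega>}"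
      using False by auto
    ultimately show ?thesis by simp
  qed
  then show ?thesis
    using nn_integral_product_layers[OF assms(1) assms(1) pos pos] by (simp add: power2_eq_square)
qed

text \<open>A minimum of two numbers is the length of the set of levels \<open>u\<close> below both of them. Writing
  \<open>F u\<close> and \<open>G u\<close> for the lengths of \<open>{s. u < \<phi> P(X > s)}\<close> and \<open>{t. u < P(Y > t)}\<close>, the double
  integral becomes \<open>\<integral> F G\<close>, and Cauchy-Schwarz separates the two variables. The same
  representation, read backwards, evaluates \<open>\<integral> F\<^sup>2 = \<phi> E X\<^sup>2\<close> and \<open>\<integral> G\<^sup>2 = E Y\<^sup>2\<close>. The functions \<open>F\<close>
  and \<open>G\<close> are the quantile functions in disguise (\<open>F\<close> rescaled by \<open>\<phi>\<close>).\<close>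
lemma nn_integral_min_tails_le:
  assumes [measurable]: "X \<in> borel_measurable M" "Y \<in> borel_measurable M"
    and pos: "\<And>\<omega>. 0 \<le> X \<omega>" "\<And>\<omega>. 0 \<le> Y \<omega>" and \<phi>: "\<phi> \<ge> 0"
  shows "(\<integral>\<^sup>+s. \<integral>\<^sup>+t. ennreal (min (\<phi> * \<P>(\<omega> in M. s < X \<omega>)) (\<P>(\<omega> in M. t < Y \<omega>)))
            \<partial>half_lebesgue \<partial>half_lebesgue)\<^sup>2
         \<le> ennreal \<phi> * (\<integral>\<^sup>+\<omega>. ennreal ((X \<omega>)\<^sup>2) \<partial>M) * (\<integral>\<^sup>+\<omega>. ennreal ((Y \<omega>)\<^sup>2) \<partial>M)"
proof -
  let ?N = half_lebesgue
  interpret N: sigma_finite_measure ?N by (rule sigma_finite_half_lebesgue)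
  define a where "a s = \<P>(\<omega> in M. s < X \<omega>)" for s
  define b where "b t = \<P>(\<omega> in M. t < Y \<omega>)" for t
  have [measurable]: "a \<in> borel_measurable borel" "b \<in> borel_measurable borel"
    by (simp_all add: a_def[abs_def] b_def[abs_def])
  have ab: "0 \<le> \<phi> * a s" "0 \<le> b s" for s using \<phi> by (auto simp: a_def b_def)
  define F where "F u = (\<integral>\<^sup>+s. indicator {s. u < \<phi> * a s} s \<partial>?N)" for u
  define G where "G u = (\<integral>\<^sup>+s. indicator {s. u < b s} s \<partial>?N)" for u
  have "(\<lambda>u. \<integral>\<^sup>+s. (if u < \<phi> * a s then 1 else 0) \<partial>?N) \<in> borel_measurable ?N"
    "(\<lambda>u. \<integral>\<^sup>+s. (if u < b s then 1 else 0) \<partial>?N) \<in> borel_measurable ?N"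
    by measurable
  then have [measurable]: "F \<in> borel_measurable ?N" "G \<in> borel_measurable ?N"
    by (simp_all add: F_def[abs_def] G_def[abs_def] indicator_def of_bool_def)
  have em: "emeasure ?N {u. u < x \<and> u < y} = ennreal (min x y)" if "0 \<le> x" "0 \<le> y" for x y
    using emeasure_half_lebesgue[of "min x y"] that by simp
  note L = nn_integral_times_layers[OF sigma_finite_half_lebesgue sigma_finite_half_lebesgue]
  have "(\<integral>\<^sup>+s. \<integral>\<^sup>+t. ennreal (min (\<phi> * a s) (b t)) \<partial>?N \<partial>?N) = (\<integral>\<^sup>+u. F u * G u \<partial>?N)"
    using L[where P="\<lambda>(u, s). u < \<phi> * a s" and Q="\<lambda>(u, s). u < b s"]
    by (simp add: F_def G_def em ab)
  then have "(\<integral>\<^sup>+s. \<integral>\<^sup>+t. ennreal (min (\<phi> * a s) (b t)) \<partial>?N \<partial>?N)\<^sup>2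
     \<le> (\<integral>\<^sup>+u. F u ^ 2 \<partial>?N) * (\<integral>\<^sup>+u. G u ^ 2 \<partial>?N)"
    using Cauchy_Schwarz_nn_integral[of F ?N G] by simp
  also have "(\<integral>\<^sup>+u. F u ^ 2 \<partial>?N) = (\<integral>\<^sup>+s. \<integral>\<^sup>+t. ennreal (min (\<phi> * a s) (\<phi> * a t)) \<partial>?N \<partial>?N)"
    using L[where P="\<lambda>(u, s). u < \<phi> * a s" and Q="\<lambda>(u, s). u < \<phi> * a s"]
    by (simp add: F_def em ab power2_eq_square)
  also have "\<dots> = (\<integral>\<^sup>+s. \<integral>\<^sup>+t. ennreal \<phi> * ennreal (min (a s) (a t)) \<partial>?N \<partial>?N)"
    using \<phi> by (intro nn_integral_cong) (simp add: ennreal_mult[symmetric] a_def min_mult_distrib_left)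
  also have "\<dots> = ennreal \<phi> * (\<integral>\<^sup>+\<omega>. ennreal ((X \<omega>)\<^sup>2) \<partial>M)"
    by (subst nn_integral_square_layers[OF assms(1) pos(1)]) (simp add: nn_integral_cmult a_def)
  also have "(\<integral>\<^sup>+u. G u ^ 2 \<partial>?N) = (\<integral>\<^sup>+\<omega>. ennreal ((Y \<omega>)\<^sup>2) \<partial>M)"
    using L[where P="\<lambda>(u, s). u < b s" and Q="\<lambda>(u, s). u < b s"]
    by (subst nn_integral_square_layers[OF assms(2) pos(2)]) (simp add: G_def em ab power2_eq_square b_def)
  finally show ?thesis by (simp add: a_def b_def)
qed

text \<open>The covariance is the double integral of \<open>P(X > s, Y > t) - P(X > s) P(Y > t)\<close>. This
  difference is at most \<open>\<phi> P(X > s)\<close> by mixing and at most \<open>P(Y > t)\<close> trivially; the second bound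
  is what brings in the second moment of \<open>Y\<close> and yields \<open>\<phi>\<close> to the power one half.\<close>
lemma covariance_nonneg_le:
  fixes X Y :: "'a \<Rightarrow> real"
  assumes XY[measurable]: "X \<in> borel_measurable M" "Y \<in> borel_measurable M"
    and pos: "\<And>\<omega>. 0 \<le> X \<omega>" "\<And>\<omega>. 0 \<le> Y \<omega>"
    and sq: "integrable M (\<lambda>\<omega>. (X \<omega>)\<^sup>2)" "integrable M (\<lambda>\<omega>. (Y \<omega>)\<^sup>2)"
    and \<phi>: "\<phi> \<ge> 0"
    and mix: "\<And>s t. \<bar>\<P>(\<omega> in M. s < X \<omega> \<and> t < Y \<omega>) - \<P>(\<omega> in M. s < X \<omega>) * \<P>(\<omega> in M. t < Y \<omega>)\<bar>
                  \<le> \<phi> * \<P>(\<omega> in M. s < X \<omega>)"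
  shows "\<bar>expectation (\<lambda>\<omega>. X \<omega> * Y \<omega>) - expectation X * expectation Y\<bar>
         \<le> sqrt (\<phi> * expectation (\<lambda>\<omega>. (X \<omega>)\<^sup>2) * expectation (\<lambda>\<omega>. (Y \<omega>)\<^sup>2))"
proof -
  let ?N = half_lebesgue
  interpret N: sigma_finite_measure ?N by (rule sigma_finite_half_lebesgue)
  define a where "a s = \<P>(\<omega> in M. s < X \<omega>)" for s
  define b where "b t = \<P>(\<omega> in M. t < Y \<omega>)" for t
  define p where "p s t = \<P>(\<omega> in M. s < X \<omega> \<and> t < Y \<omega>)" for s t
  define r where "r s t = min (\<phi> * a s) (b t)" for s t
  define R where "R = (\<integral>\<^sup>+s. \<integral>\<^sup>+t. ennreal (r s t) \<partial>?N \<partial>?N)"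
  let ?B = "sqrt (\<phi> * expectation (\<lambda>\<omega>. (X \<omega>)\<^sup>2) * expectation (\<lambda>\<omega>. (Y \<omega>)\<^sup>2))"
  have ab: "0 \<le> a s" "a s \<le> 1" "0 \<le> b s" "b s \<le> 1" "0 \<le> p s t" "0 \<le> r s t" "p s t \<le> b t" for s t
    using \<phi> by (auto simp: a_def b_def p_def r_def intro!: finite_measure_mono)
  have [measurable]: "a \<in> borel_measurable borel" "b \<in> borel_measurable borel"
    by (simp_all add: a_def[abs_def] b_def[abs_def])
  have rm[measurable]: "case_prod r \<in> borel_measurable (borel \<Otimes>\<^sub>M borel)"
    by (simp add: r_def[abs_def])
  have pm[measurable]: "(\<lambda>(s,t). ennreal (p s t)) \<in> borel_measurable (borel \<Otimes>\<^sub>M borel)"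
  proof -
    have "(\<lambda>z. \<integral>\<^sup>+\<omega>. (if fst z < X \<omega> \<and> snd z < Y \<omega> then 1 else 0) \<partial>M) \<in> borel_measurable (borel \<Otimes>\<^sub>M borel)"
      by measurable
    moreover have "(\<integral>\<^sup>+\<omega>. (if s < X \<omega> \<and> t < Y \<omega> then 1 else 0) \<partial>M) = ennreal (p s t)" for s t
    proof -
      have "(\<integral>\<^sup>+\<omega>. (if s < X \<omega> \<and> t < Y \<omega> then 1 else 0) \<partial>M)
          = (\<integral>\<^sup>+\<omega>. indicator {\<omega> \<in> space M. s < X \<omega> \<and> t < Y \<omega>} \<omega> \<partial>M)"
        by (intro nn_integral_cong) (simp add: indicator_def)
      then show ?thesis by (simp add: emeasure_eq_measure p_def)
    qed
    ultimately show ?thesis by (simp add: case_prod_beta')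
  qed
  have iX: "integrable M X" "integrable M Y"
    using square_integrable_imp_integrable[OF XY(1) sq(1)] square_integrable_imp_integrable[OF XY(2) sq(2)] .
  have iXY: "integrable M (\<lambda>\<omega>. X \<omega> * Y \<omega>)"
    by (rule integrable_mult_of_squares[OF XY sq])
  have r_le: "\<bar>p s t - a s * b t\<bar> \<le> r s t" for s t
  proof -
    have "\<bar>p s t - a s * b t\<bar> \<le> b t"
      using ab(5,7)[of s t] ab(3)[of t] ab(1,2)[of s] mult_left_le_one_le[of "b t" "a s"]
        mult_nonneg_nonneg[of "a s" "b t"] by linarith
    then show ?thesis using mix[of s t] by (simp add: p_def a_def b_def r_def)
  qed
  have E1: "(\<integral>\<^sup>+s. \<integral>\<^sup>+t. ennreal (p s t) \<partial>?N \<partial>?N) = ennreal (expectation (\<lambda>\<omega>. X \<omega> * Y \<omega>))"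
    using nn_integral_product_layers[OF XY pos] nn_integral_eq_integral[OF iXY] by (simp add: p_def pos)
  have E2: "(\<integral>\<^sup>+s. \<integral>\<^sup>+t. ennreal (a s * b t) \<partial>?N \<partial>?N) = ennreal (expectation X * expectation Y)"
  proof -
    have "(\<integral>\<^sup>+s. \<integral>\<^sup>+t. ennreal (a s * b t) \<partial>?N \<partial>?N) = (\<integral>\<^sup>+s. ennreal (a s) \<partial>?N) * (\<integral>\<^sup>+t. ennreal (b t) \<partial>?N)"
      by (simp add: ennreal_mult ab nn_integral_cmult nn_integral_multc)
    then show ?thesis
      using nn_integral_layers[OF XY(1) pos(1)] nn_integral_layers[OF XY(2) pos(2)]
        nn_integral_eq_integral[OF iX(1)] nn_integral_eq_integral[OF iX(2)]
      by (simp add: pos a_def b_def ennreal_mult)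
  qed
  have "R\<^sup>2 \<le> ennreal (\<phi> * expectation (\<lambda>\<omega>. (X \<omega>)\<^sup>2) * expectation (\<lambda>\<omega>. (Y \<omega>)\<^sup>2))"
    using nn_integral_min_tails_le[OF XY pos \<phi>] nn_integral_eq_integral[OF sq(1)] nn_integral_eq_integral[OF sq(2)] \<phi>
    by (simp add: R_def r_def a_def b_def ennreal_mult)
  also have "\<dots> = (ennreal ?B)\<^sup>2" using \<phi> by (simp add: ennreal_power)
  finally have R2: "R\<^sup>2 \<le> (ennreal ?B)\<^sup>2" .
  have B0: "0 \<le> ?B" using \<phi> by simp
  have R_le: "R \<le> ennreal ?B"
  proof (cases R rule: ennreal_cases)
    case (real r)
    then have "r\<^sup>2 \<le> ?B\<^sup>2"
      using R2 B0 by (simp only: ennreal_power ennreal_le_iff zero_le_power2)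
    then have "r \<le> ?B" using B0 by (rule power2_le_imp_le)
    then show ?thesis using real by (simp add: ennreal_leI)
  next
    case top
    then have "top \<le> ennreal (?B\<^sup>2)"
      using R2 B0 by (simp only: ennreal_power) simp
    then show ?thesis by (simp add: top_unique)
  qed
  have E0: "0 \<le> expectation X * expectation Y" "0 \<le> expectation (\<lambda>\<omega>. X \<omega> * Y \<omega>)"
    by (simp_all add: pos)
  \<comment> \<open>The two inequalities below work with extended nonnegative integrals, where subtraction is
    unavailable: each side is bounded by the other one plus the error term \<open>R\<close>.\<close>
  have add: "(\<integral>\<^sup>+s. \<integral>\<^sup>+t. ennreal (f s t + r s t) \<partial>?N \<partial>?N) = (\<integral>\<^sup>+s. \<integral>\<^sup>+t. ennreal (f s t) \<partial>?N \<partial>?N) + R"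
    if [measurable]: "(\<lambda>(s,t). ennreal (f s t)) \<in> borel_measurable (borel \<Otimes>\<^sub>M borel)" and "\<And>s t. 0 \<le> f s t" for f
  proof -
    have [measurable]: "(\<lambda>(s,t). ennreal (f s t)) \<in> borel_measurable (?N \<Otimes>\<^sub>M ?N)"
      "(\<lambda>(s,t). ennreal (r s t)) \<in> borel_measurable (?N \<Otimes>\<^sub>M ?N)"
      using that(1) rm by (simp_all cong: measurable_cong_sets sets_pair_measure_cong add: r_def)
    have [measurable]: "(\<lambda>s. \<integral>\<^sup>+t. ennreal (f s t) \<partial>?N) \<in> borel_measurable ?N"
      "(\<lambda>s. \<integral>\<^sup>+t. ennreal (r s t) \<partial>?N) \<in> borel_measurable ?N"
      by (rule N.borel_measurable_nn_integral; measurable)+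
    have "(\<integral>\<^sup>+s. \<integral>\<^sup>+t. ennreal (f s t + r s t) \<partial>?N \<partial>?N)
        = (\<integral>\<^sup>+s. (\<integral>\<^sup>+t. ennreal (f s t) \<partial>?N) + (\<integral>\<^sup>+t. ennreal (r s t) \<partial>?N) \<partial>?N)"
    proof (intro nn_integral_cong)
      fix s
      have m: "(\<lambda>t. ennreal (f s t)) \<in> borel_measurable ?N" "(\<lambda>t. ennreal (r s t)) \<in> borel_measurable ?N"
        by measurable
      show "(\<integral>\<^sup>+t. ennreal (f s t + r s t) \<partial>?N) = (\<integral>\<^sup>+t. ennreal (f s t) \<partial>?N) + (\<integral>\<^sup>+t. ennreal (r s t) \<partial>?N)"
        by (subst nn_integral_add[OF m, symmetric]) (simp add: that(2) ab)
    qed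
    then show ?thesis
      unfolding R_def by (subst nn_integral_add[symmetric]) simp_all
  qed
  have "ennreal (expectation (\<lambda>\<omega>. X \<omega> * Y \<omega>)) \<le> (\<integral>\<^sup>+s. \<integral>\<^sup>+t. ennreal (a s * b t + r s t) \<partial>?N \<partial>?N)"
    unfolding E1[symmetric] using r_le by (intro nn_integral_mono ennreal_leI) (smt (verit))
  also have "\<dots> = ennreal (expectation X * expectation Y) + R"
    unfolding E2[symmetric] by (rule add) (auto simp: ab)
  also have "\<dots> \<le> ennreal (expectation X * expectation Y) + ennreal ?B"
    by (intro add_left_mono R_le)
  finally have 1: "expectation (\<lambda>\<omega>. X \<omega> * Y \<omega>) \<le> expectation X * expectation Y + ?B"
    using E0 B0 by (simp only: ennreal_plus[symmetric] ennreal_le_iff add_nonneg_nonneg)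
  have "ennreal (expectation X * expectation Y) \<le> (\<integral>\<^sup>+s. \<integral>\<^sup>+t. ennreal (p s t + r s t) \<partial>?N \<partial>?N)"
    unfolding E2[symmetric] using r_le by (intro nn_integral_mono ennreal_leI) (smt (verit))
  also have "\<dots> = ennreal (expectation (\<lambda>\<omega>. X \<omega> * Y \<omega>)) + R"
    unfolding E1[symmetric] by (rule add[OF pm]) (auto simp: ab)
  also have "\<dots> \<le> ennreal (expectation (\<lambda>\<omega>. X \<omega> * Y \<omega>)) + ennreal ?B"
    by (intro add_left_mono R_le)
  finally have 2: "expectation X * expectation Y \<le> expectation (\<lambda>\<omega>. X \<omega> * Y \<omega>) + ?B"
    using E0 B0 by (simp only: ennreal_plus[symmetric] ennreal_le_iff add_nonneg_nonneg)
  from 1 2 show ?thesis by linarith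
qed

text \<open>The positive and the negative part of a random variable are Borel functions of it, so the
  mixing bound passes to them; the factor 4 counts the pairs of parts.\<close>
lemma covariance_le:
  fixes X Y :: "'a \<Rightarrow> real"
  assumes XY[measurable]: "X \<in> borel_measurable M" "Y \<in> borel_measurable M"
    and sq: "integrable M (\<lambda>\<omega>. (X \<omega>)\<^sup>2)" "integrable M (\<lambda>\<omega>. (Y \<omega>)\<^sup>2)"
    and \<phi>: "\<phi> \<ge> 0"
    and mix: "\<And>S T. S \<in> sets borel \<Longrightarrow> T \<in> sets borel \<Longrightarrow>
       \<bar>\<P>(\<omega> in M. X \<omega> \<in> S \<and> Y \<omega> \<in> T) - \<P>(\<omega> in M. X \<omega> \<in> S) * \<P>(\<omega> in M. Y \<omega> \<in> T)\<bar>
       \<le> \<phi> * \<P>(\<omega> in M. X \<omega> \<in> S)"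
  shows "\<bar>expectation (\<lambda>\<omega>. X \<omega> * Y \<omega>) - expectation X * expectation Y\<bar>
         \<le> 4 * sqrt (\<phi> * expectation (\<lambda>\<omega>. (X \<omega>)\<^sup>2) * expectation (\<lambda>\<omega>. (Y \<omega>)\<^sup>2))" (is "_ \<le> 4 * ?B")
proof -
  \<comment> \<open>\<open>pt 1\<close> is the positive part and \<open>pt (- 1)\<close> the negative part.\<close>
  define pt :: "real \<Rightarrow> real \<Rightarrow> real" where "pt e x = max 0 (e * x)" for e x
  have [measurable]: "pt e \<in> borel_measurable borel" for e
    by (simp add: pt_def[abs_def])
  have pt_nonneg: "0 \<le> pt e x" for e x
    by (simp add: pt_def)
  have sqi: "integrable M (\<lambda>\<omega>. (pt e (Z \<omega>))\<^sup>2)"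
    and le: "expectation (\<lambda>\<omega>. (pt e (Z \<omega>))\<^sup>2) \<le> expectation (\<lambda>\<omega>. (Z \<omega>)\<^sup>2)"
    if [measurable]: "Z \<in> borel_measurable M" and "integrable M (\<lambda>\<omega>. (Z \<omega>)\<^sup>2)" "e \<in> {1, -1}" for Z e
  proof -
    have *: "(pt e x)\<^sup>2 \<le> x\<^sup>2" for x
      using that by (auto simp: pt_def max_def)
    show i: "integrable M (\<lambda>\<omega>. (pt e (Z \<omega>))\<^sup>2)"
      by (rule Bochner_Integration.integrable_bound[OF that(2)]) (use * in auto)
    show "expectation (\<lambda>\<omega>. (pt e (Z \<omega>))\<^sup>2) \<le> expectation (\<lambda>\<omega>. (Z \<omega>)\<^sup>2)"
      by (intro integral_mono i that *)
  qed
  have int: "integrable M (\<lambda>\<omega>. pt e (Z \<omega>))"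
    if [measurable]: "Z \<in> borel_measurable M" and "integrable M (\<lambda>\<omega>. (Z \<omega>)\<^sup>2)" "e \<in> {1, -1}" for Z e
    by (rule square_integrable_imp_integrable[OF _ sqi[OF that]]) simp
  have int2: "integrable M (\<lambda>\<omega>. pt d (X \<omega>) * pt e (Y \<omega>))" if "d \<in> {1, -1}" "e \<in> {1,-1}" for d e
    by (rule integrable_mult_of_squares[OF _ _ sqi[OF XY(1) sq(1) that(1)] sqi[OF XY(2) sq(2) that(2)]]) simp_all
  define c where "c d e = expectation (\<lambda>\<omega>. pt d (X \<omega>) * pt e (Y \<omega>))
      - expectation (\<lambda>\<omega>. pt d (X \<omega>)) * expectation (\<lambda>\<omega>. pt e (Y \<omega>))" for d e
  have c: "\<bar>c d e\<bar> \<le> ?B" if de: "d \<in> {1, -1}" "e \<in> {1,-1}" for d e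
  proof -
    have "\<bar>c d e\<bar> \<le> sqrt (\<phi> * expectation (\<lambda>\<omega>. (pt d (X \<omega>))\<^sup>2) * expectation (\<lambda>\<omega>. (pt e (Y \<omega>))\<^sup>2))"
      unfolding c_def
    proof (rule covariance_nonneg_le)
      fix s t
      have "pt e -` {s<..} \<in> sets borel" for e s
        using measurable_sets[of "pt e" borel borel "{s<..}"] by simp
      from mix[OF this this, of d s e t]
      show "\<bar>\<P>(\<omega> in M. s < pt d (X \<omega>) \<and> t < pt e (Y \<omega>)) - \<P>(\<omega> in M. s < pt d (X \<omega>)) * \<P>(\<omega> in M. t < pt e (Y \<omega>))\<bar>
        \<le> \<phi> * \<P>(\<omega> in M. s < pt d (X \<omega>))" by simp
    qed (simp_all add: sqi[OF XY(1) sq(1) de(1)] sqi[OF XY(2) sq(2) de(2)] \<phi> pt_nonneg)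
    also have "\<dots> \<le> ?B"
      by (intro real_sqrt_le_mono mult_mono le sq de \<phi> mult_nonneg_nonneg) auto
    finally show ?thesis .
  qed
  have split: "x = pt 1 x - pt (-1) x" for x by (simp add: pt_def max_def)
  have prod_split: "x * y = pt 1 x * pt 1 y - pt 1 x * pt (-1) y - pt (-1) x * pt 1 y + pt (-1) x * pt (-1) y" for x y
  proof -
    have "x * y = (pt 1 x - pt (-1) x) * (pt 1 y - pt (-1) y)" by (simp only: split[symmetric])
    then show ?thesis by (simp add: algebra_simps)
  qed
  have EX: "expectation X = expectation (\<lambda>\<omega>. pt 1 (X \<omega>)) - expectation (\<lambda>\<omega>. pt (-1) (X \<omega>))"
    by (subst Bochner_Integration.integral_diff[symmetric]) (simp_all add: int XY sq split[symmetric])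
  have EY: "expectation Y = expectation (\<lambda>\<omega>. pt 1 (Y \<omega>)) - expectation (\<lambda>\<omega>. pt (-1) (Y \<omega>))"
    by (subst Bochner_Integration.integral_diff[symmetric]) (simp_all add: int XY sq split[symmetric])
  have "expectation (\<lambda>\<omega>. X \<omega> * Y \<omega>) = expectation (\<lambda>\<omega>. pt 1 (X \<omega>) * pt 1 (Y \<omega>) - pt 1 (X \<omega>) * pt (-1) (Y \<omega>)
     - pt (-1) (X \<omega>) * pt 1 (Y \<omega>) + pt (-1) (X \<omega>) * pt (-1) (Y \<omega>))"
    by (intro Bochner_Integration.integral_cong refl prod_split)
  also have "\<dots> = expectation (\<lambda>\<omega>. pt 1 (X \<omega>) * pt 1 (Y \<omega>)) - expectation (\<lambda>\<omega>. pt 1 (X \<omega>) * pt (-1) (Y \<omega>))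
     - expectation (\<lambda>\<omega>. pt (-1) (X \<omega>) * pt 1 (Y \<omega>)) + expectation (\<lambda>\<omega>. pt (-1) (X \<omega>) * pt (-1) (Y \<omega>))"
    by (simp add: int2)
  finally have "expectation (\<lambda>\<omega>. X \<omega> * Y \<omega>) - expectation X * expectation Y
      = c 1 1 - c 1 (-1) - c (-1) 1 + c (-1) (-1)"
    unfolding EX EY c_def by (simp add: algebra_simps)
  then show ?thesis using c[of 1 1] c[of 1 "-1"] c[of "-1" 1] c[of "-1" "-1"] by simp
qed

end

section \<open>Stationary random fields and separated sets of sites\<close>

text \<open>Two sets of sites have a gap \<open>r\<close> if a hyperplane orthogonal to some coordinate axis has the
  first set on its left and the second one at distance \<open>r\<close> to its right. The case \<open>r = 0\<close> imposes
  nothing, in accordance with \<open>phi M \<xi> 0 = 1\<close>; together with truncated subtraction this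
  lets one formula cover near and distant sites.\<close>
definition separated :: "nat \<Rightarrow> (int ^ 'q) set \<Rightarrow> (int ^ 'q) set \<Rightarrow> bool" where
  "separated r I J \<longleftrightarrow> r = 0 \<or> (\<exists>k t. (\<forall>i\<in>I. i $ k \<le> t) \<and> (\<forall>j\<in>J. t + int r \<le> j $ k))"

locale stationary_field = prob_space M for M :: "'w measure" +
  fixes \<xi> :: "int ^ 'q \<Rightarrow> 'w \<Rightarrow> real ^ 'p"
  assumes \<xi>_measurable [measurable]: "\<And>i. \<xi> i \<in> borel_measurable M"
    and stationary: "strictly_stationary M \<xi>"
begin

abbreviation restr :: "(int ^ 'q) set \<Rightarrow> 'w \<Rightarrow> int ^ 'q \<Rightarrow> real ^ 'p" where
  "restr I \<omega> \<equiv> (\<lambda>i\<in>I. \<xi> i \<omega>)"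

text \<open>Stationarity transfers from the joint law of finitely many sites to every measurable
  function of them; this is the only form in which it is used.\<close>
lemma shift_distr:
  assumes "finite I" and f[measurable]: "f \<in> measurable (Pi\<^sub>M I (\<lambda>_. borel)) N"
  shows "distr M N (\<lambda>\<omega>. f (\<lambda>i\<in>I. \<xi> (i + h) \<omega>)) = distr M N (\<lambda>\<omega>. f (restr I \<omega>))"
proof -
  have "distr (distr M (Pi\<^sub>M I (\<lambda>_. borel)) (\<lambda>\<omega>. \<lambda>i\<in>I. \<xi> (i + h) \<omega>)) N f
      = distr (distr M (Pi\<^sub>M I (\<lambda>_. borel)) (\<lambda>\<omega>. \<lambda>i\<in>I. \<xi> i \<omega>)) N f"
    using stationary \<open>finite I\<close> unfolding strictly_stationary_def by simp
  then show ?thesis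
    by (simp add: distr_distr comp_def)
qed

lemma shift_prob:
  assumes "finite I" and f[measurable]: "f \<in> measurable (Pi\<^sub>M I (\<lambda>_. borel)) N" and S[measurable]: "S \<in> sets N"
  shows "\<P>(\<omega> in M. f (\<lambda>i\<in>I. \<xi> (i + h) \<omega>) \<in> S) = \<P>(\<omega> in M. f (restr I \<omega>) \<in> S)"
proof -
  have "measure (distr M N (\<lambda>\<omega>. f (\<lambda>i\<in>I. \<xi> (i + h) \<omega>))) S = measure (distr M N (\<lambda>\<omega>. f (restr I \<omega>))) S"
    by (simp add: shift_distr[OF assms(1,2)])
  then show ?thesis
    by (simp add: measure_distr vimage_def Int_def conj_commute)
qed

lemma shift_expectation:
  fixes f :: "_ \<Rightarrow> real"
  assumes "finite I" and f[measurable]: "f \<in> borel_measurable (Pi\<^sub>M I (\<lambda>_. borel))"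
  shows "expectation (\<lambda>\<omega>. f (\<lambda>i\<in>I. \<xi> (i + h) \<omega>)) = expectation (\<lambda>\<omega>. f (restr I \<omega>))"
    and "integrable M (\<lambda>\<omega>. f (\<lambda>i\<in>I. \<xi> (i + h) \<omega>)) \<longleftrightarrow> integrable M (\<lambda>\<omega>. f (restr I \<omega>))"
proof -
  note eq = shift_distr[OF assms, of h]
  have "(\<integral>x. x \<partial>distr M borel (\<lambda>\<omega>. f (\<lambda>i\<in>I. \<xi> (i + h) \<omega>))) = (\<integral>x. x \<partial>distr M borel (\<lambda>\<omega>. f (restr I \<omega>)))"
    by (simp add: eq)
  then show "expectation (\<lambda>\<omega>. f (\<lambda>i\<in>I. \<xi> (i + h) \<omega>)) = expectation (\<lambda>\<omega>. f (restr I \<omega>))"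
    by (simp add: integral_distr)
  have "integrable (distr M borel (\<lambda>\<omega>. f (\<lambda>i\<in>I. \<xi> (i + h) \<omega>))) (\<lambda>x. x) \<longleftrightarrow> integrable (distr M borel (\<lambda>\<omega>. f (restr I \<omega>))) (\<lambda>x. x)"
    by (simp add: eq)
  then show "integrable M (\<lambda>\<omega>. f (\<lambda>i\<in>I. \<xi> (i + h) \<omega>)) \<longleftrightarrow> integrable M (\<lambda>\<omega>. f (restr I \<omega>))"
    by (simp add: integrable_distr_eq)
qed

lemma field_sigma_generators:
  "{\<xi> i -` B \<inter> space M | i B. i \<in> I \<and> B \<in> sets borel} \<subseteq> Pow (space M)"
  by auto

lemma field_sigma_subset: "field_sigma M \<xi> I \<subseteq> events"
  unfolding field_sigma_def by (intro sets.sigma_sets_subset) auto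

lemma field_sigma_space: "space M \<in> field_sigma M \<xi> I"
  unfolding field_sigma_def by (rule sigma_sets_top)

text \<open>The generated \<open>\<sigma>\<close>-algebra is viewed as a measure space in its own right, so that membership of
  an event follows from ordinary measurability with respect to it.\<close>
lemma field_sigma_event:
  assumes "I \<subseteq> J" and u[measurable]: "u \<in> measurable (Pi\<^sub>M I (\<lambda>_. borel)) N" and S[measurable]: "S \<in> sets N"
  shows "{\<omega> \<in> space M. u (restr I \<omega>) \<in> S} \<in> field_sigma M \<xi> J"
proof -
  let ?G = "{\<xi> i -` B \<inter> space M | i B. i \<in> J \<and> B \<in> sets borel}"
  let ?M = "sigma (space M) ?G"
  have sp: "space ?M = space M" by (rule space_measure_of[OF field_sigma_generators])
  have se: "sets ?M = field_sigma M \<xi> J"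
    unfolding field_sigma_def by (rule sets_measure_of[OF field_sigma_generators])
  have [measurable]: "\<xi> i \<in> borel_measurable ?M" if "i \<in> J" for i
  proof (rule measurableI)
    fix B :: "(real ^ 'p) set" assume "B \<in> sets borel"
    with that show "\<xi> i -` B \<inter> space ?M \<in> sets ?M"
      unfolding se sp field_sigma_def by (intro sigma_sets.Basic) auto
  qed simp
  have r: "(\<lambda>\<omega>. restr I \<omega>) \<in> measurable ?M (Pi\<^sub>M I (\<lambda>_. borel))"
    using assms(1) by (intro measurable_restrict) auto
  have "(\<lambda>\<omega>. u (restr I \<omega>)) \<in> measurable ?M N"
    by (rule measurable_compose[OF r u])
  from measurable_sets[OF this S] show ?thesis
    unfolding se sp by (simp add: vimage_def Int_def conj_commute)
qed

text \<open>The supremum defining the mixing coefficient is taken over a set bounded by 1, hence it is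
  an upper bound and not a default value.\<close>
lemma phi_dir_ge:
  assumes "A \<in> sigma_minus M \<xi> k 0" "B \<in> sigma_plus M \<xi> k r" "prob A > 0"
  shows "\<bar>\<P>(\<omega> in M. \<omega> \<in> B \<bar> \<omega> \<in> A) - prob B\<bar> \<le> phi_dir M \<xi> k r"
proof -
  have "bdd_above {\<bar>\<P>(\<omega> in M. \<omega> \<in> B \<bar> \<omega> \<in> A) - prob B\<bar> | A B.
      A \<in> sigma_minus M \<xi> k 0 \<and> B \<in> sigma_plus M \<xi> k r \<and> prob A > 0}"
  proof (rule bdd_aboveI, safe)
    fix A B assume A: "A \<in> sigma_minus M \<xi> k 0" "B \<in> sigma_plus M \<xi> k r" "prob A > 0"
    then have [measurable]: "A \<in> events" "B \<in> events"
      using field_sigma_subset by (auto simp: sigma_minus_def sigma_plus_def)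
    have "0 \<le> \<P>(\<omega> in M. \<omega> \<in> B \<bar> \<omega> \<in> A)" "\<P>(\<omega> in M. \<omega> \<in> B \<bar> \<omega> \<in> A) \<le> 1"
      using A(3) by (auto simp: cond_prob_def divide_le_eq intro!: finite_measure_mono)
    then show "\<bar>\<P>(\<omega> in M. \<omega> \<in> B \<bar> \<omega> \<in> A) - prob B\<bar> \<le> 1"
      using prob_le_1[of B] measure_nonneg[of M B] by linarith
  qed
  then show ?thesis
    unfolding phi_dir_def using assms by (intro cSup_upper) auto
qed

lemma phi_dir_le_phi: "r \<noteq> 0 \<Longrightarrow> phi_dir M \<xi> k r \<le> phi M \<xi> r"
  by (simp add: phi_def)

lemma phi_nonneg: "0 \<le> phi M \<xi> r"
proof (cases "r = 0")
  case False
  have "0 \<le> phi_dir M \<xi> k r" for k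
    using phi_dir_ge[of "space M" k "space M" r] field_sigma_space
    by (simp add: sigma_minus_def sigma_plus_def prob_space)
  then show ?thesis using phi_dir_le_phi[OF False] order_trans by blast
qed (simp add: phi_def)

lemma phi_event_bound:
  assumes "r \<noteq> 0" and A: "A \<in> sigma_minus M \<xi> k 0" and B: "B \<in> sigma_plus M \<xi> k r"
  shows "\<bar>prob (A \<inter> B) - prob A * prob B\<bar> \<le> phi M \<xi> r * prob A"
proof (cases "prob A > 0")
  case True
  have [measurable]: "A \<in> events" "B \<in> events"
    using A B field_sigma_subset by (auto simp: sigma_minus_def sigma_plus_def)
  have "{\<omega> \<in> space M. \<omega> \<in> B \<and> \<omega> \<in> A} = A \<inter> B" "{\<omega> \<in> space M. \<omega> \<in> A} = A"
    using sets.sets_into_space[of A M] by auto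
  then have "\<bar>prob (A \<inter> B) / prob A - prob B\<bar> \<le> phi M \<xi> r"
    using phi_dir_ge[OF A B True] phi_dir_le_phi[OF \<open>r \<noteq> 0\<close>, of k] by (simp add: cond_prob_def)
  then have "\<bar>prob (A \<inter> B) / prob A - prob B\<bar> * prob A \<le> phi M \<xi> r * prob A"
    using True by (intro mult_right_mono) auto
  also have "\<bar>prob (A \<inter> B) / prob A - prob B\<bar> * prob A = \<bar>prob (A \<inter> B) - prob A * prob B\<bar>"
    using True by (simp add: abs_mult_pos[symmetric] field_simps)
  finally show ?thesis .
next
  case False
  have [measurable]: "A \<in> events" "B \<in> events"
    using A B field_sigma_subset by (auto simp: sigma_minus_def sigma_plus_def)
  have "prob A = 0" using False measure_nonneg[of M A] by linarith
  moreover have "prob (A \<inter> B) \<le> prob A" by (rule finite_measure_mono) auto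
  ultimately show ?thesis using measure_nonneg[of M "A \<inter> B"] by simp
qed

text \<open>The mixing coefficients refer to the hyperplane through the origin. A translation carries
  the separating hyperplane there, and stationarity of the law of \<open>I \<union> J\<close> (for the joint event)
  and of \<open>I\<close> and \<open>J\<close> (for the single events) shows that no probability changes.\<close>
lemma separated_event_bound:
  assumes fin: "finite I" "finite J" and sep: "separated r I J"
    and u[measurable]: "u \<in> borel_measurable (Pi\<^sub>M I (\<lambda>_. borel))"
    and v[measurable]: "v \<in> borel_measurable (Pi\<^sub>M J (\<lambda>_. borel))"
    and S[measurable]: "S \<in> sets borel" and T[measurable]: "T \<in> sets borel"
  shows "\<bar>\<P>(\<omega> in M. u (restr I \<omega>) \<in> S \<and> v (restr J \<omega>) \<in> T)
           - \<P>(\<omega> in M. u (restr I \<omega>) \<in> S) * \<P>(\<omega> in M. v (restr J \<omega>) \<in> T)\<bar>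
         \<le> phi M \<xi> r * \<P>(\<omega> in M. u (restr I \<omega>) \<in> S)"
proof (cases "r = 0")
  case True
  have "\<P>(\<omega> in M. u (restr I \<omega>) \<in> S \<and> v (restr J \<omega>) \<in> T) \<le> \<P>(\<omega> in M. u (restr I \<omega>) \<in> S)"
    by (rule finite_measure_mono) auto
  moreover have "\<P>(\<omega> in M. u (restr I \<omega>) \<in> S) * \<P>(\<omega> in M. v (restr J \<omega>) \<in> T) \<le> \<P>(\<omega> in M. u (restr I \<omega>) \<in> S)"
    by (rule mult_right_le_one_le) auto
  moreover have "0 \<le> \<P>(\<omega> in M. u (restr I \<omega>) \<in> S) * \<P>(\<omega> in M. v (restr J \<omega>) \<in> T)" by simp
  moreover have "0 \<le> \<P>(\<omega> in M. u (restr I \<omega>) \<in> S \<and> v (restr J \<omega>) \<in> T)" by simp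
  ultimately have "\<bar>\<P>(\<omega> in M. u (restr I \<omega>) \<in> S \<and> v (restr J \<omega>) \<in> T)
           - \<P>(\<omega> in M. u (restr I \<omega>) \<in> S) * \<P>(\<omega> in M. v (restr J \<omega>) \<in> T)\<bar>
         \<le> \<P>(\<omega> in M. u (restr I \<omega>) \<in> S)" by linarith
  then show ?thesis by (simp add: True phi_def)
next
  case False
  then obtain k t where I: "\<And>i. i \<in> I \<Longrightarrow> i $ k \<le> t" and J: "\<And>j. j \<in> J \<Longrightarrow> t + int r \<le> j $ k"
    using sep by (auto simp: separated_def)
  define h :: "int ^ 'q" where "h = (\<chi> l. - t)"
  define I' J' where "I' = (\<lambda>i. i + h) ` I" and "J' = (\<lambda>j. j + h) ` J"
  define u' where "u' x = u (\<lambda>i\<in>I. x (i + h))" for x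
  define v' where "v' x = v (\<lambda>j\<in>J. x (j + h))" for x
  have u'm: "u' \<in> borel_measurable (Pi\<^sub>M I' (\<lambda>_. borel))" and v'm: "v' \<in> borel_measurable (Pi\<^sub>M J' (\<lambda>_. borel))"
    unfolding u'_def v'_def I'_def J'_def
    by (auto intro!: measurable_compose[OF _ u] measurable_compose[OF _ v] measurable_restrict measurable_component_singleton)
  have u'eq: "u' (restr I' \<omega>) = u (\<lambda>i\<in>I. \<xi> (i + h) \<omega>)" and v'eq: "v' (restr J' \<omega>) = v (\<lambda>j\<in>J. \<xi> (j + h) \<omega>)" for \<omega>
    unfolding u'_def v'_def I'_def J'_def
    by (auto intro!: arg_cong[where f=u] arg_cong[where f=v])
  define A where "A = {\<omega> \<in> space M. u (\<lambda>i\<in>I. \<xi> (i + h) \<omega>) \<in> S}"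
  define B where "B = {\<omega> \<in> space M. v (\<lambda>j\<in>J. \<xi> (j + h) \<omega>) \<in> T}"
  have "A \<in> sigma_minus M \<xi> k 0"
    unfolding sigma_minus_def A_def u'eq[symmetric]
    by (rule field_sigma_event[OF _ u'm S]) (auto simp: I'_def h_def dest: I)
  moreover have "B \<in> sigma_plus M \<xi> k r"
    unfolding sigma_plus_def B_def v'eq[symmetric]
    by (rule field_sigma_event[OF _ v'm T]) (auto simp: J'_def h_def dest: J)
  ultimately have *: "\<bar>prob (A \<inter> B) - prob A * prob B\<bar> \<le> phi M \<xi> r * prob A"
    using phi_event_bound[OF False] by blast
  have PA: "prob A = \<P>(\<omega> in M. u (restr I \<omega>) \<in> S)" and PB: "prob B = \<P>(\<omega> in M. v (restr J \<omega>) \<in> T)"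
    unfolding A_def B_def by (rule shift_prob[OF fin(1) u S], rule shift_prob[OF fin(2) v T])
  define f where "f x = (u (restrict x I), v (restrict x J))" for x
  have f: "f \<in> measurable (Pi\<^sub>M (I \<union> J) (\<lambda>_. borel)) (borel \<Otimes>\<^sub>M borel)"
    unfolding f_def by (intro measurable_Pair measurable_compose[OF _ u] measurable_compose[OF _ v] measurable_restrict_subset) auto
  have ff: "f (\<lambda>i\<in>I \<union> J. z i) = (u (\<lambda>i\<in>I. z i), v (\<lambda>j\<in>J. z j))" for z
    unfolding f_def by (auto simp: restrict_def intro!: arg_cong[where f=u] arg_cong[where f=v])
  have "prob (A \<inter> B) = \<P>(\<omega> in M. f (\<lambda>i\<in>I \<union> J. \<xi> (i + h) \<omega>) \<in> S \<times> T)"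
    unfolding ff A_def B_def by (rule arg_cong[where f=prob]) auto
  also have "\<dots> = \<P>(\<omega> in M. f (restr (I \<union> J) \<omega>) \<in> S \<times> T)"
    using fin by (intro shift_prob[OF _ f]) auto
  also have "\<dots> = \<P>(\<omega> in M. u (restr I \<omega>) \<in> S \<and> v (restr J \<omega>) \<in> T)"
    unfolding ff by simp
  finally show ?thesis using * unfolding PA PB by simp
qed

text \<open>This is the only consequence of mixing needed later. It bounds the autocovariances, with one
  site on each side, and the covariances of the lag products, with two sites on each side.\<close>
lemma separated_covariance_bound:
  assumes fin: "finite I" "finite J" and sep: "separated r I J"
    and u[measurable]: "u \<in> borel_measurable (Pi\<^sub>M I (\<lambda>_. borel))"
    and v[measurable]: "v \<in> borel_measurable (Pi\<^sub>M J (\<lambda>_. borel))"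
    and sq: "integrable M (\<lambda>\<omega>. (u (restr I \<omega>))\<^sup>2)" "integrable M (\<lambda>\<omega>. (v (restr J \<omega>))\<^sup>2)"
  shows "\<bar>expectation (\<lambda>\<omega>. u (restr I \<omega>) * v (restr J \<omega>))
            - expectation (\<lambda>\<omega>. u (restr I \<omega>)) * expectation (\<lambda>\<omega>. v (restr J \<omega>))\<bar>
         \<le> 4 * sqrt (phi M \<xi> r * expectation (\<lambda>\<omega>. (u (restr I \<omega>))\<^sup>2) * expectation (\<lambda>\<omega>. (v (restr J \<omega>))\<^sup>2))"
  by (rule covariance_le[OF _ _ sq phi_nonneg separated_event_bound[OF fin sep u v]]) simp_all

end

section \<open>Counting lattice points\<close>

definition sup_norm :: "int ^ 'q \<Rightarrow> nat" where
  "sup_norm d = Max (range (\<lambda>k. nat \<bar>d $ k\<bar>))"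

lemma sup_norm_le_iff: "sup_norm d \<le> s \<longleftrightarrow> (\<forall>k. \<bar>d $ k\<bar> \<le> int s)"
  by (auto simp: sup_norm_def nat_le_iff)

lemma abs_le_sup_norm: "\<bar>d $ k\<bar> \<le> int (sup_norm d)"
  using sup_norm_le_iff[of d "sup_norm d"] by simp

lemma sup_norm_attained: obtains k where "\<bar>d $ k\<bar> = int (sup_norm d)"
proof -
  have "sup_norm d \<in> range (\<lambda>k. nat \<bar>d $ k\<bar>)"
    unfolding sup_norm_def by (rule Max_in) auto
  then show ?thesis using that by fastforce
qed

lemma card_vec_product:
  fixes S :: "'q::finite \<Rightarrow> 'a set"
  assumes "\<And>l. finite (S l)"
  shows "finite {d :: 'a ^ 'q. \<forall>l. d $ l \<in> S l}" (is "finite ?D")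
    and "card {d :: 'a ^ 'q. \<forall>l. d $ l \<in> S l} = (\<Prod>l\<in>UNIV. card (S l))"
proof -
  have b: "bij_betw vec_nth ?D (PiE UNIV S)"
    by (rule bij_betw_byWitness[where f'=vec_lambda]) (auto simp: PiE_def Pi_def)
  have "finite (PiE UNIV S)" using assms by (intro finite_PiE) auto
  then show "finite ?D" using bij_betw_finite[OF b] by simp
  show "card ?D = (\<Prod>l\<in>UNIV. card (S l))"
    using bij_betw_same_card[OF b] assms by (simp add: card_PiE)
qed

lemma card_cube:
  "finite {d :: int ^ 'q. sup_norm d \<le> s}"
  "card {d :: int ^ 'q. sup_norm d \<le> s} = (2 * s + 1) ^ CARD('q)"
proof -
  have *: "{d :: int ^ 'q. sup_norm d \<le> s} = {d. \<forall>l. d $ l \<in> {- int s..int s}}"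
    by (auto simp: sup_norm_le_iff abs_le_iff minus_le_iff)
  show "finite {d :: int ^ 'q. sup_norm d \<le> s}"
    unfolding * by (rule card_vec_product) simp
  have "nat (2 * int s + 1) = 2 * s + 1" by simp
  then show "card {d :: int ^ 'q. sup_norm d \<le> s} = (2 * s + 1) ^ CARD('q)"
    unfolding * by (subst card_vec_product) (simp_all add: algebra_simps)
qed

text \<open>Some coordinate of a point of the sphere of radius \<open>s\<close> has absolute value \<open>s\<close>, so the sphere
  is covered by the \<open>2 q\<close> faces of a cube.\<close>
lemma card_sphere_le:
  "card {d :: int ^ 'q. sup_norm d = s} \<le> 2 * CARD('q) * (2 * s + 1) ^ (CARD('q) - 1)"
proof -
  define F where "F k = {d :: int ^ 'q. \<forall>l. d $ l \<in> (if l = k then {- int s, int s} else {- int s..int s})}" for k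
  have fin: "finite (F k)" for k
    unfolding F_def by (rule card_vec_product) simp
  have c: "card (F k) \<le> 2 * (2 * s + 1) ^ (CARD('q) - 1)" for k
  proof -
    have n: "nat (2 * int s + 1) = 2 * s + 1" by simp
    have "card (F k) = (\<Prod>l\<in>UNIV. card (if l = k then {- int s, int s} else {- int s..int s}))"
      unfolding F_def by (rule card_vec_product) simp
    also have "\<dots> = card {- int s, int s} * (\<Prod>l\<in>UNIV - {k}. card (if l = k then {- int s, int s} else {- int s..int s}))"
      by (subst prod.remove[of _ k]) auto
    also have "(\<Prod>l\<in>UNIV - {k}. card (if l = k then {- int s, int s} else {- int s..int s})) = (\<Prod>l\<in>UNIV - {k}. 2 * s + 1)"
      by (intro prod.cong) (auto simp: n)
    also have "\<dots> = (2 * s + 1) ^ (CARD('q) - 1)" by (simp add: card_Diff_singleton)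
    also have "card {- int s, int s} * \<dots> \<le> 2 * (2 * s + 1) ^ (CARD('q) - 1)"
      by (intro mult_right_mono) (auto simp: card_insert_if)
    finally show ?thesis .
  qed
  have sub: "{d :: int ^ 'q. sup_norm d = s} \<subseteq> (\<Union>k. F k)"
  proof
    fix d :: "int ^ 'q" assume d: "d \<in> {d. sup_norm d = s}"
    obtain k where k: "\<bar>d $ k\<bar> = int (sup_norm d)" by (rule sup_norm_attained)
    have "d \<in> F k"
      using d k abs_le_sup_norm[of d] by (auto simp: F_def abs_le_iff minus_le_iff abs_eq_iff)
    then show "d \<in> (\<Union>k. F k)" by blast
  qed
  have "card {d :: int ^ 'q. sup_norm d = s} \<le> card (\<Union>k. F k)"
    by (rule card_mono[OF _ sub]) (simp add: fin)
  also have "\<dots> \<le> (\<Sum>k\<in>UNIV. card (F k))" by (rule card_UN_le) simp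
  also have "\<dots> \<le> (\<Sum>k\<in>(UNIV :: 'q set). 2 * (2 * s + 1) ^ (CARD('q) - 1))"
    by (intro sum_mono c)
  also have "\<dots> = 2 * CARD('q) * (2 * s + 1) ^ (CARD('q) - 1)" by simp
  finally show ?thesis .
qed

text \<open>The cube of radius \<open>L\<close> contributes its volume. Outside it, the sphere of radius \<open>L + r\<close> has
  at most a constant times \<open>(L + r)\<^bsup>q-1\<^esup> \<le> ((1 + L) r)\<^bsup>q-1\<^esup>\<close> points, where \<open>r \<ge> 1\<close>. Thus \<open>L\<close> costs
  only a factor of order \<open>(1 + L)\<^bsup>q\<^esup>\<close> and what remains is the assumed series.\<close>
lemma lattice_sum_le:
  fixes a :: "nat \<Rightarrow> real" and D :: "(int ^ 'q) set"
  assumes pos: "\<And>r. 0 \<le> a r" and a0: "a 0 \<le> 1" and fin: "finite D"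
    and summ: "summable (\<lambda>r. real (Suc r) ^ (CARD('q) - 1) * a (Suc r))"
  shows "(\<Sum>d\<in>D. a (sup_norm d - L))
       \<le> (3 * (1 + real L)) ^ CARD('q) * (1 + 2 * real CARD('q) * (\<Sum>r. real (Suc r) ^ (CARD('q) - 1) * a (Suc r)))"
    (is "_ \<le> ?K ^ CARD('q) * (1 + 2 * real CARD('q) * ?S)")
proof -
  define D1 where "D1 = {d \<in> D. sup_norm d \<le> L}"
  define D2 where "D2 = {d \<in> D. \<not> sup_norm d \<le> L}"
  let ?q = "CARD('q)"
  have q: "?q = Suc (?q - 1)" by simp
  have S0: "0 \<le> ?S" by (intro suminf_nonneg summ mult_nonneg_nonneg pos) auto
  have "(\<Sum>d\<in>D1. a (sup_norm d - L)) \<le> (\<Sum>d\<in>D1. 1)"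
    using a0 by (intro sum_mono) (simp add: D1_def)
  also have "\<dots> = real (card D1)" by simp
  also have "card D1 \<le> card {d :: int ^ 'q. sup_norm d \<le> L}"
    by (intro card_mono card_cube) (auto simp: D1_def)
  also have "real (card {d :: int ^ 'q. sup_norm d \<le> L}) = (2 * real L + 1) ^ ?q"
    by (simp add: card_cube add.commute)
  also have "\<dots> \<le> ?K ^ ?q" by (intro power_mono) auto
  finally have 1: "(\<Sum>d\<in>D1. a (sup_norm d - L)) \<le> ?K ^ ?q" by simp
  \<comment> \<open>Shifted by one, so that the values of \<open>h\<close> index the series, which is summed over \<open>Suc r\<close>.\<close>
  define h where "h d = sup_norm d - L - 1" for d :: "int ^ 'q"
  have hS: "sup_norm d - L = Suc (h d)" if "d \<in> D2" for d
    using that by (auto simp: D2_def h_def)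
  have "(\<Sum>d\<in>D2. a (sup_norm d - L)) = (\<Sum>d\<in>D2. a (Suc (h d)))"
    by (intro sum.cong refl) (simp only: hS)
  also have "\<dots> = (\<Sum>r\<in>h ` D2. \<Sum>d\<in>{d \<in> D2. h d = r}. a (Suc (h d)))"
    by (rule sum.image_gen) (simp add: D2_def fin)
  also have "\<dots> = (\<Sum>r\<in>h ` D2. real (card {d \<in> D2. h d = r}) * a (Suc r))"
    by (intro sum.cong refl) simp
  also have "\<dots> \<le> (\<Sum>r\<in>h ` D2. (2 * real ?q * ?K ^ (?q - 1)) * (real (Suc r) ^ (?q - 1) * a (Suc r)))"
  proof (intro sum_mono)
    fix r
    have "card {d \<in> D2. h d = r} \<le> card {d :: int ^ 'q. sup_norm d = L + Suc r}"
      by (intro card_mono finite_subset[OF _ card_cube(1)[of "L + Suc r"]]) (auto simp: D2_def h_def)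
    also have "\<dots> \<le> 2 * ?q * (2 * (L + Suc r) + 1) ^ (?q - 1)" by (rule card_sphere_le)
    finally have "real (card {d \<in> D2. h d = r}) \<le> real (2 * ?q * (2 * (L + Suc r) + 1) ^ (?q - 1))"
      by (simp only: of_nat_le_iff)
    also have "\<dots> = 2 * real ?q * (2 * (real L + real (Suc r)) + 1) ^ (?q - 1)"
      by simp
    also have "\<dots> \<le> 2 * real ?q * (?K * real (Suc r)) ^ (?q - 1)"
    proof (intro mult_left_mono power_mono)
      have "?K * real (Suc r) = 3 + 3 * real r + 3 * real L + 3 * (real L * real r)" by (simp add: algebra_simps)
      moreover have "0 \<le> real L * real r" by simp
      ultimately show "2 * (real L + real (Suc r)) + 1 \<le> ?K * real (Suc r)"
        by simp
    qed auto
    finally have "real (card {d \<in> D2. h d = r}) * a (Suc r) \<le> 2 * real ?q * (?K * real (Suc r)) ^ (?q - 1) * a (Suc r)"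
      by (rule mult_right_mono) (rule pos)
    then show "real (card {d \<in> D2. h d = r}) * a (Suc r) \<le> (2 * real ?q * ?K ^ (?q - 1)) * (real (Suc r) ^ (?q - 1) * a (Suc r))"
      by (simp only: power_mult_distrib mult.assoc)
  qed
  also have "\<dots> = (2 * real ?q * ?K ^ (?q - 1)) * (\<Sum>r\<in>h ` D2. real (Suc r) ^ (?q - 1) * a (Suc r))"
    by (simp only: sum_distrib_left)
  also have "\<dots> \<le> (2 * real ?q * ?K ^ ?q) * ?S"
  proof (rule mult_mono)
    show "(\<Sum>r\<in>h ` D2. real (Suc r) ^ (?q - 1) * a (Suc r)) \<le> ?S"
      using pos fin by (intro sum_le_suminf[OF summ]) (auto simp: D2_def)
    show "2 * real ?q * ?K ^ (?q - 1) \<le> 2 * real ?q * ?K ^ ?q"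
      by (intro mult_left_mono power_increasing) auto
  qed (auto intro!: sum_nonneg mult_nonneg_nonneg pos)
  finally have 2: "(\<Sum>d\<in>D2. a (sup_norm d - L)) \<le> (2 * real ?q * ?K ^ ?q) * ?S" .
  have "(\<Sum>d\<in>D. a (sup_norm d - L)) = (\<Sum>d\<in>D1. a (sup_norm d - L)) + (\<Sum>d\<in>D2. a (sup_norm d - L))"
    unfolding D1_def D2_def using fin by (subst sum.union_disjoint[symmetric]) (auto intro!: sum.cong)
  also have "\<dots> \<le> ?K ^ ?q + (2 * real ?q * ?K ^ ?q) * ?S" by (rule add_mono[OF 1 2])
  also have "\<dots> = ?K ^ ?q * (1 + 2 * real ?q * ?S)" by (simp add: algebra_simps)
  finally show ?thesis .
qed

section \<open>Entrywise criteria and a moment inequality\<close>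

lemma borel_measurable_vec_nth [measurable (raw)]:
  fixes f :: "'a \<Rightarrow> ('b :: real_normed_vector) ^ 'n"
  assumes "f \<in> borel_measurable M"
  shows "(\<lambda>x. f x $ i) \<in> borel_measurable M"
  by (rule measurable_compose[OF assms borel_measurable_continuous_onI]) (intro continuous_intros)

lemma integrable_vecI:
  fixes f :: "'a \<Rightarrow> ('b :: euclidean_space) ^ 'n"
  assumes f: "f \<in> borel_measurable M" and comp: "\<And>i. integrable M (\<lambda>x. f x $ i)"
  shows "integrable M f"
proof (rule Bochner_Integration.integrable_bound)
  show "integrable M (\<lambda>x. \<Sum>i\<in>UNIV. norm (f x $ i))" using comp by (intro Bochner_Integration.integrable_sum) auto
  have "norm (f x) \<le> (\<Sum>i\<in>UNIV. norm (f x $ i))" for x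
    by (simp add: norm_vec_def L2_set_le_sum)
  then show "AE x in M. norm (f x) \<le> norm (\<Sum>i\<in>UNIV. norm (f x $ i))"
    by (intro AE_I2) (simp add: sum_nonneg)
qed fact

lemma integral_vec_nth:
  fixes f :: "'a \<Rightarrow> ('b :: euclidean_space) ^ 'n"
  shows "integrable M f \<Longrightarrow> (\<integral>x. f x \<partial>M) $ i = (\<integral>x. f x $ i \<partial>M)"
  using integral_bounded_linear[OF bounded_linear_vec_nth, of M f i] by simp

text \<open>Vector- and matrix-valued integrals and sums are only needed to read off the entries of
  \<^const>\<open>asym_var\<close>; applying the entrywise criterion twice covers matrices.\<close>
lemma has_sum_vecI:
  fixes f :: "'a \<Rightarrow> ('b :: euclidean_space) ^ 'n"
  assumes "\<And>i. ((\<lambda>x. f x $ i) has_sum (S $ i)) A"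
  shows "(f has_sum S) A"
  using assms unfolding has_sum_def by (intro vec_tendstoI) simp

lemma (in prob_space) expectation_abs_le_sqrt:
  fixes X :: "'a \<Rightarrow> real"
  assumes [measurable]: "X \<in> borel_measurable M" and "integrable M (\<lambda>\<omega>. (X \<omega>)\<^sup>2)"
  shows "expectation (\<lambda>\<omega>. \<bar>X \<omega>\<bar>) \<le> sqrt (expectation (\<lambda>\<omega>. (X \<omega>)\<^sup>2))"
proof -
  have "integrable M X" by (rule square_integrable_imp_integrable) fact+
  then have "variance (\<lambda>\<omega>. \<bar>X \<omega>\<bar>) = expectation (\<lambda>\<omega>. \<bar>X \<omega>\<bar>\<^sup>2) - (expectation (\<lambda>\<omega>. \<bar>X \<omega>\<bar>))\<^sup>2"
    using assms by (intro variance_eq) auto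
  moreover have "0 \<le> variance (\<lambda>\<omega>. \<bar>X \<omega>\<bar>)" by (rule variance_positive)
  ultimately have "(expectation (\<lambda>\<omega>. \<bar>X \<omega>\<bar>))\<^sup>2 \<le> expectation (\<lambda>\<omega>. (X \<omega>)\<^sup>2)" by simp
  then show ?thesis by (rule real_le_rsqrt)
qed

section \<open>Autocovariances and their estimators\<close>

text \<open>In a coordinate where \<open>i' - i\<close> attains its norm, the pairs \<open>{i, i + j}\<close> and \<open>{i', i' + j}\<close> occupy
  intervals of length \<open>\<bar>j $ k\<bar> \<le> L\<close> whose left ends differ by that norm. Which pair
  lies on the left depends on the sign, and since the covariance is symmetric either order serves.\<close>
lemma separated_pairs:
  fixes i i' j :: "int ^ 'q"
  assumes "sup_norm j \<le> L"
  shows "separated (sup_norm (i' - i) - L) {i, i + j} {i', i' + j}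
       \<or> separated (sup_norm (i' - i) - L) {i', i' + j} {i, i + j}"
proof (cases "sup_norm (i' - i) \<le> L")
  case True
  then show ?thesis by (simp add: separated_def)
next
  case False
  obtain k where k: "\<bar>(i' - i) $ k\<bar> = int (sup_norm (i' - i))" by (rule sup_norm_attained)
  have j: "\<bar>j $ k\<bar> \<le> int L"
    using assms by (simp add: sup_norm_le_iff)
  show ?thesis
  proof (cases "i $ k \<le> i' $ k")
    case True
    have "separated (sup_norm (i' - i) - L) {i, i + j} {i', i' + j}"
      unfolding separated_def
      by (rule disjI2, rule exI[of _ k], rule exI[of _ "i $ k + max 0 (j $ k)"])
         (use True False k j in auto)
    then show ?thesis ..
  next
    case False': False
    have "separated (sup_norm (i' - i) - L) {i', i' + j} {i, i + j}"
      unfolding separated_def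
      by (rule disjI2, rule exI[of _ k], rule exI[of _ "i' $ k + max 0 (j $ k)"])
         (use False' False k j in auto)
    then show ?thesis ..
  qed
qed

locale mixing_field = stationary_field M \<xi> for M :: "'w measure" and \<xi> :: "int ^ 'q \<Rightarrow> 'w \<Rightarrow> real ^ 'p" +
  assumes centered: "(\<integral>\<omega>. \<xi> 0 \<omega> \<partial>M) = 0"
    and fourth: "\<And>\<nu>. integrable M (\<lambda>\<omega>. (\<xi> 0 \<omega> $ \<nu>) ^ 4)"
    and summable_phi: "summable (\<lambda>r. real (Suc r) ^ (CARD('q) - 1) * sqrt (phi M \<xi> (Suc r)))"
begin

text \<open>The sum over the components is a bound for each of them that does not depend on the
  entry of the covariance matrix under consideration.\<close>
definition mom4 :: real where "mom4 = (\<Sum>\<nu>\<in>UNIV. expectation (\<lambda>\<omega>. (\<xi> 0 \<omega> $ \<nu>) ^ 4))"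

definition autocov :: "'p \<Rightarrow> 'p \<Rightarrow> int ^ 'q \<Rightarrow> real" where
  "autocov \<nu> \<mu> j = expectation (\<lambda>\<omega>. \<xi> 0 \<omega> $ \<nu> * \<xi> j \<omega> $ \<mu>)"

definition phi_const :: real where
  "phi_const = 1 + 2 * real CARD('q) * (\<Sum>r. real (Suc r) ^ (CARD('q) - 1) * sqrt (phi M \<xi> (Suc r)))"

lemma phi_const_nonneg: "0 \<le> phi_const"
  unfolding phi_const_def using summable_phi phi_nonneg
  by (intro add_nonneg_nonneg mult_nonneg_nonneg suminf_nonneg) auto

lemma sum_sqrt_phi_le:
  fixes D :: "(int ^ 'q) set"
  assumes "finite D"
  shows "(\<Sum>d\<in>D. sqrt (phi M \<xi> (sup_norm d - L))) \<le> (3 * (1 + real L)) ^ CARD('q) * phi_const"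
  unfolding phi_const_def
  by (rule lattice_sum_le[OF _ _ assms summable_phi]) (auto simp: phi_nonneg, simp add: phi_def)

lemma comp_measurable [measurable]: "(\<lambda>\<omega>. \<xi> i \<omega> $ \<nu>) \<in> borel_measurable M"
  using \<xi>_measurable[of i] by measurable

lemma fourth_at: "integrable M (\<lambda>\<omega>. (\<xi> i \<omega> $ \<nu>) ^ 4)"
  and fourth_le: "expectation (\<lambda>\<omega>. (\<xi> i \<omega> $ \<nu>) ^ 4) \<le> mom4"
proof -
  have m: "(\<lambda>x. (x 0 $ \<nu>) ^ 4) \<in> borel_measurable (Pi\<^sub>M {0 :: int ^ 'q} (\<lambda>_. borel :: (real ^ 'p) measure))"
    by measurable
  show "integrable M (\<lambda>\<omega>. (\<xi> i \<omega> $ \<nu>) ^ 4)"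
    using shift_expectation(2)[OF _ m, of i] fourth[of \<nu>] by simp
  have "expectation (\<lambda>\<omega>. (\<xi> i \<omega> $ \<nu>) ^ 4) = expectation (\<lambda>\<omega>. (\<xi> 0 \<omega> $ \<nu>) ^ 4)"
    using shift_expectation(1)[OF _ m, of i] by simp
  also have "\<dots> \<le> mom4"
    unfolding mom4_def by (rule member_le_sum) auto
  finally show "expectation (\<lambda>\<omega>. (\<xi> i \<omega> $ \<nu>) ^ 4) \<le> mom4" .
qed

lemma mom4_nonneg: "0 \<le> mom4"
  unfolding mom4_def by (intro sum_nonneg) simp

lemma square_at: "integrable M (\<lambda>\<omega>. (\<xi> i \<omega> $ \<nu>)\<^sup>2)"
  by (rule square_integrable_imp_integrable) (use fourth_at in \<open>simp_all add: power_mult[symmetric]\<close>)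

lemma integrable_at: "integrable M (\<lambda>\<omega>. \<xi> i \<omega> $ \<nu>)"
  by (rule square_integrable_imp_integrable[OF _ square_at]) simp

lemma square_product: "integrable M (\<lambda>\<omega>. (\<xi> i \<omega> $ \<nu> * \<xi> j \<omega> $ \<mu>)\<^sup>2)"
  and square_product_le: "expectation (\<lambda>\<omega>. (\<xi> i \<omega> $ \<nu> * \<xi> j \<omega> $ \<mu>)\<^sup>2) \<le> mom4"
proof -
  have *: "integrable M (\<lambda>\<omega>. (\<xi> i \<omega> $ \<nu>)\<^sup>2 * (\<xi> j \<omega> $ \<mu>)\<^sup>2)"
    by (rule integrable_mult_of_squares) (use fourth_at in \<open>simp_all add: power_mult[symmetric]\<close>)
  then show 1: "integrable M (\<lambda>\<omega>. (\<xi> i \<omega> $ \<nu> * \<xi> j \<omega> $ \<mu>)\<^sup>2)" by (simp add: power_mult_distrib)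
  have "expectation (\<lambda>\<omega>. (\<xi> i \<omega> $ \<nu> * \<xi> j \<omega> $ \<mu>)\<^sup>2)
      \<le> expectation (\<lambda>\<omega>. ((\<xi> i \<omega> $ \<nu>) ^ 4 + (\<xi> j \<omega> $ \<mu>) ^ 4) / 2)"
  proof (rule integral_mono[OF 1])
    fix \<omega>
    show "(\<xi> i \<omega> $ \<nu> * \<xi> j \<omega> $ \<mu>)\<^sup>2 \<le> ((\<xi> i \<omega> $ \<nu>) ^ 4 + (\<xi> j \<omega> $ \<mu>) ^ 4) / 2"
      using sum_squares_bound[of "(\<xi> i \<omega> $ \<nu>)\<^sup>2" "(\<xi> j \<omega> $ \<mu>)\<^sup>2"]
      by (simp add: power_mult[symmetric] power_mult_distrib)
  qed (use fourth_at in auto)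
  also have "\<dots> = (expectation (\<lambda>\<omega>. (\<xi> i \<omega> $ \<nu>) ^ 4) + expectation (\<lambda>\<omega>. (\<xi> j \<omega> $ \<mu>) ^ 4)) / 2"
    using fourth_at by simp
  also have "\<dots> \<le> mom4" using fourth_le[of i \<nu>] fourth_le[of j \<mu>] by simp
  finally show "expectation (\<lambda>\<omega>. (\<xi> i \<omega> $ \<nu> * \<xi> j \<omega> $ \<mu>)\<^sup>2) \<le> mom4" .
qed

lemma integrable_product: "integrable M (\<lambda>\<omega>. \<xi> i \<omega> $ \<nu> * \<xi> j \<omega> $ \<mu>)"
  by (rule square_integrable_imp_integrable[OF _ square_product]) simp

lemma expectation_lag_product: "expectation (\<lambda>\<omega>. \<xi> i \<omega> $ \<nu> * \<xi> (i + j) \<omega> $ \<mu>) = autocov \<nu> \<mu> j"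
proof -
  have m: "(\<lambda>x. x 0 $ \<nu> * x j $ \<mu>) \<in> borel_measurable (Pi\<^sub>M {0, j} (\<lambda>_. borel :: (real ^ 'p) measure))"
    by measurable
  show ?thesis
    using shift_expectation(1)[OF _ m, of i] by (simp add: autocov_def add.commute)
qed

lemma expectation_at: "expectation (\<lambda>\<omega>. \<xi> 0 \<omega> $ \<nu>) = 0"
proof -
  have "integrable M (\<xi> 0)" by (rule integrable_vecI[OF \<xi>_measurable integrable_at])
  from integral_vec_nth[OF this, of \<nu>] centered show ?thesis by simp
qed

text \<open>The components are centred, so an autocovariance at lag \<open>k\<close> is a covariance across a gap of
  size \<open>sup_norm k\<close>. The lattice sum with \<open>L = 0\<close> bounds all finite partial sums.\<close>
lemma autocov_summable: "(\<lambda>k. norm (autocov \<nu> \<mu> k)) summable_on UNIV"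
proof -
  define B where "B = 4 * (1 + mom4)"
  have sq: "expectation (\<lambda>\<omega>. (\<xi> i \<omega> $ \<nu>)\<^sup>2) \<le> 1 + mom4" for i \<nu>
  proof -
    have "expectation (\<lambda>\<omega>. (\<xi> i \<omega> $ \<nu>)\<^sup>2) \<le> expectation (\<lambda>\<omega>. 1 + (\<xi> i \<omega> $ \<nu>) ^ 4)"
    proof (rule integral_mono[OF square_at])
      fix \<omega> show "(\<xi> i \<omega> $ \<nu>)\<^sup>2 \<le> 1 + (\<xi> i \<omega> $ \<nu>) ^ 4"
      proof -
        have "2 * (\<xi> i \<omega> $ \<nu>)\<^sup>2 \<le> (\<xi> i \<omega> $ \<nu>) ^ 4 + 1"
          using sum_squares_bound[of "(\<xi> i \<omega> $ \<nu>)\<^sup>2" 1] by (simp add: power_mult[symmetric])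
        then show ?thesis using zero_le_power2[of "\<xi> i \<omega> $ \<nu>"] by linarith
      qed
    qed (use fourth_at in auto)
    also have "\<dots> = 1 + expectation (\<lambda>\<omega>. (\<xi> i \<omega> $ \<nu>) ^ 4)"
      using fourth_at by (simp add: prob_space)
    finally show ?thesis using fourth_le[of i \<nu>] by simp
  qed
  have bound: "\<bar>autocov \<nu> \<mu> k\<bar> \<le> B * sqrt (phi M \<xi> (sup_norm k - 0))" for k
  proof -
    let ?r = "sup_norm k"
    have cov: "\<bar>expectation (\<lambda>\<omega>. \<xi> i \<omega> $ \<alpha> * \<xi> j \<omega> $ \<beta>) - expectation (\<lambda>\<omega>. \<xi> i \<omega> $ \<alpha>) * expectation (\<lambda>\<omega>. \<xi> j \<omega> $ \<beta>)\<bar>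
        \<le> 4 * sqrt (phi M \<xi> ?r * (1 + mom4) * (1 + mom4))" if "separated ?r {i} {j}" for i j \<alpha> \<beta>
    proof -
      have "\<bar>expectation (\<lambda>\<omega>. \<xi> i \<omega> $ \<alpha> * \<xi> j \<omega> $ \<beta>) - expectation (\<lambda>\<omega>. \<xi> i \<omega> $ \<alpha>) * expectation (\<lambda>\<omega>. \<xi> j \<omega> $ \<beta>)\<bar>
        \<le> 4 * sqrt (phi M \<xi> ?r * expectation (\<lambda>\<omega>. (\<xi> i \<omega> $ \<alpha>)\<^sup>2) * expectation (\<lambda>\<omega>. (\<xi> j \<omega> $ \<beta>)\<^sup>2))"
        using separated_covariance_bound[OF _ _ that, of "\<lambda>x. x i $ \<alpha>" "\<lambda>x. x j $ \<beta>"] square_at by simp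
      also have "\<dots> \<le> 4 * sqrt (phi M \<xi> ?r * (1 + mom4) * (1 + mom4))"
        using mom4_nonneg phi_nonneg by (intro mult_left_mono real_sqrt_le_mono mult_mono sq) auto
      finally show ?thesis .
    qed
    have "sqrt (phi M \<xi> ?r * (1 + mom4) * (1 + mom4)) = sqrt (phi M \<xi> ?r) * (1 + mom4)"
      using mom4_nonneg by (simp add: real_sqrt_mult)
    then have B: "4 * sqrt (phi M \<xi> ?r * (1 + mom4) * (1 + mom4)) = B * sqrt (phi M \<xi> (?r - 0))"
      by (simp add: B_def)
    obtain l where l: "\<bar>k $ l\<bar> = int ?r" by (rule sup_norm_attained)
    have "separated ?r {0} {k} \<or> separated ?r {k} {0}"
    proof (cases "k $ l \<ge> 0")
      case True
      then have "separated ?r {0} {k}"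
        unfolding separated_def by (intro disjI2 exI[of _ l] exI[of _ 0]) (use l in auto)
      then show ?thesis ..
    next
      case False
      then have "separated ?r {k} {0}"
        unfolding separated_def by (intro disjI2 exI[of _ l] exI[of _ "k $ l"]) (use l in auto)
      then show ?thesis ..
    qed
    then consider "separated ?r {0} {k}" | "separated ?r {k} {0}" by blast
    then show ?thesis
    proof cases
      case 1
      from cov[OF this, of \<nu> \<mu>] show ?thesis unfolding B by (simp add: autocov_def expectation_at)
    next
      case 2
      from cov[OF this, of \<mu> \<nu>] show ?thesis unfolding B by (simp add: autocov_def expectation_at mult.commute)
    qed
  qed
  have B0: "0 \<le> B" using mom4_nonneg by (simp add: B_def)
  have "(\<Sum>k\<in>F. \<bar>autocov \<nu> \<mu> k\<bar>) \<le> B * (3 ^ CARD('q) * phi_const)" if "finite F" for F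
  proof -
    have "(\<Sum>k\<in>F. \<bar>autocov \<nu> \<mu> k\<bar>) \<le> (\<Sum>k\<in>F. B * sqrt (phi M \<xi> (sup_norm k - 0)))"
      by (rule sum_mono[OF bound])
    also have "\<dots> = B * (\<Sum>k\<in>F. sqrt (phi M \<xi> (sup_norm k - 0)))" by (simp only: sum_distrib_left)
    also have "\<dots> \<le> B * ((3 * (1 + real 0)) ^ CARD('q) * phi_const)"
      by (intro mult_left_mono sum_sqrt_phi_le that B0)
    finally show ?thesis by simp
  qed
  then show ?thesis
    unfolding Infinite_Sum.abs_summable_iff_bdd_above by (intro bdd_aboveI[where M="B * (3 ^ CARD('q) * phi_const)"]) auto
qed

lemma asym_var_nth: "asym_var M \<xi> $ \<nu> $ \<mu> = (\<Sum>\<^sub>\<infinity>k\<in>UNIV. autocov \<nu> \<mu> k)"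
proof -
  have "continuous_on UNIV (\<lambda>z :: (real ^ 'p) \<times> (real ^ 'p). outer (fst z) (snd z))"
    unfolding outer_def by (intro continuous_intros)
  then have o: "(\<lambda>z :: (real ^ 'p) \<times> (real ^ 'p). outer (fst z) (snd z)) \<in> borel_measurable borel"
    by (rule borel_measurable_continuous_onI)
  have m: "(\<lambda>\<omega>. outer (\<xi> 0 \<omega>) (\<xi> k \<omega>)) \<in> borel_measurable M" for k
    using measurable_compose[OF _ o, of "\<lambda>\<omega>. (\<xi> 0 \<omega>, \<xi> k \<omega>)" M] by simp
  have row: "(\<lambda>\<omega>. outer (\<xi> 0 \<omega>) (\<xi> k \<omega>) $ \<nu>) \<in> borel_measurable M" for k \<nu>
    using m[of k] by measurable
  have i1: "integrable M (\<lambda>\<omega>. outer (\<xi> 0 \<omega>) (\<xi> k \<omega>) $ \<nu>)" for k \<nu>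
    by (rule integrable_vecI[OF row]) (simp add: outer_def integrable_product)
  have i2: "integrable M (\<lambda>\<omega>. outer (\<xi> 0 \<omega>) (\<xi> k \<omega>))" for k
    by (rule integrable_vecI[OF m i1])
  have comp: "(\<integral>\<omega>. outer (\<xi> 0 \<omega>) (\<xi> k \<omega>) \<partial>M) $ \<nu> $ \<mu> = autocov \<nu> \<mu> k" for k \<nu> \<mu>
    by (simp add: integral_vec_nth[OF i2] integral_vec_nth[OF i1]) (simp add: outer_def autocov_def)
  have "((\<lambda>k. \<integral>\<omega>. outer (\<xi> 0 \<omega>) (\<xi> k \<omega>) \<partial>M) has_sum (\<chi> \<nu> \<mu>. \<Sum>\<^sub>\<infinity>k\<in>UNIV. autocov \<nu> \<mu> k)) UNIV"
    by (intro has_sum_vecI) (simp add: comp has_sum_infsum Infinite_Sum.abs_summable_summable[OF autocov_summable])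
  from infsumI[OF this] show ?thesis by (simp add: asym_var_def)
qed

lemma covariance_products_le:
  assumes "sup_norm j \<le> L"
  shows "\<bar>expectation (\<lambda>\<omega>. (\<xi> i \<omega> $ \<nu> * \<xi> (i + j) \<omega> $ \<mu>) * (\<xi> i' \<omega> $ \<nu> * \<xi> (i' + j) \<omega> $ \<mu>)) - (autocov \<nu> \<mu> j)\<^sup>2\<bar>
         \<le> 4 * mom4 * sqrt (phi M \<xi> (sup_norm (i' - i) - L))"
proof -
  let ?r = "sup_norm (i' - i) - L"
  define Z where "Z i \<omega> = \<xi> i \<omega> $ \<nu> * \<xi> (i + j) \<omega> $ \<mu>" for i \<omega>
  have main: "\<bar>expectation (\<lambda>\<omega>. Z a \<omega> * Z b \<omega>) - (autocov \<nu> \<mu> j)\<^sup>2\<bar> \<le> 4 * mom4 * sqrt (phi M \<xi> ?r)"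
    if sep: "separated ?r {a, a + j} {b, b + j}" for a b
  proof -
    have "\<bar>expectation (\<lambda>\<omega>. Z a \<omega> * Z b \<omega>) - (autocov \<nu> \<mu> j)\<^sup>2\<bar>
        \<le> 4 * sqrt (phi M \<xi> ?r * expectation (\<lambda>\<omega>. (Z a \<omega>)\<^sup>2) * expectation (\<lambda>\<omega>. (Z b \<omega>)\<^sup>2))"
      using separated_covariance_bound[OF _ _ sep, of "\<lambda>x. x a $ \<nu> * x (a + j) $ \<mu>" "\<lambda>x. x b $ \<nu> * x (b + j) $ \<mu>"]
        square_product
      by (simp add: Z_def expectation_lag_product power2_eq_square[of "autocov _ _ _"])
    also have "\<dots> \<le> 4 * sqrt (phi M \<xi> ?r * mom4 * mom4)"
      using mom4_nonneg phi_nonneg unfolding Z_def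
      by (intro mult_left_mono real_sqrt_le_mono mult_mono square_product_le) auto
    also have "\<dots> = 4 * mom4 * sqrt (phi M \<xi> ?r)"
      using mom4_nonneg by (simp add: real_sqrt_mult)
    finally show ?thesis .
  qed
  from separated_pairs[OF assms, of i' i] show ?thesis
  proof
    assume "separated ?r {i, i + j} {i', i' + j}"
    from main[OF this] show ?thesis by (simp add: Z_def)
  next
    assume "separated ?r {i', i' + j} {i, i + j}"
    from main[OF this] show ?thesis by (simp add: Z_def mult.commute)
  qed
qed

lemma gamma_hat_nth:
  "gamma_hat \<xi> n j \<omega> $ \<nu> $ \<mu> = (\<Sum>i\<in>Gam_lag n j. \<xi> i \<omega> $ \<nu> * \<xi> (i + j) \<omega> $ \<mu>) / real (card (Gam_lag n j))"
  by (simp add: gamma_hat_def outer_def)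

lemma gamma_hat_measurable [measurable]: "(\<lambda>\<omega>. gamma_hat \<xi> n j \<omega> $ \<nu> $ \<mu>) \<in> borel_measurable M"
  unfolding gamma_hat_nth by measurable

lemma gamma_hat_integrable: "integrable M (\<lambda>\<omega>. gamma_hat \<xi> n j \<omega> $ \<nu> $ \<mu>)"
  unfolding gamma_hat_nth by (intro integrable_divide Bochner_Integration.integrable_sum integrable_product)

text \<open>The expected square is a double average of covariances of lag products. For a fixed first
  site the covariances are summable over the second one, with a bound of order \<open>(1 + L)\<^bsup>q\<^esup>\<close>; this
  removes one of the two factors \<open>1 / N\<close>.\<close>
lemma gamma_hat_L1_bound:
  assumes "sup_norm j \<le> L" and fin: "finite (Gam_lag n j)" and pos: "card (Gam_lag n j) > 0"
  shows "expectation (\<lambda>\<omega>. \<bar>gamma_hat \<xi> n j \<omega> $ \<nu> $ \<mu> - autocov \<nu> \<mu> j\<bar>)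
       \<le> sqrt (4 * mom4 * ((3 * (1 + real L)) ^ CARD('q) * phi_const) / real (card (Gam_lag n j)))"
proof -
  let ?G = "Gam_lag n j" and ?N = "real (card (Gam_lag n j))" and ?\<gamma> = "autocov \<nu> \<mu> j"
  let ?B = "4 * mom4 * ((3 * (1 + real L)) ^ CARD('q) * phi_const)"
  define Z where "Z i \<omega> = \<xi> i \<omega> $ \<nu> * \<xi> (i + j) \<omega> $ \<mu>" for i \<omega>
  have [measurable]: "Z i \<in> borel_measurable M" for i unfolding Z_def[abs_def] by measurable
  have Z1: "integrable M (Z i)" "expectation (Z i) = ?\<gamma>" for i
    using integrable_product expectation_lag_product by (auto simp: Z_def[abs_def])
  have Z2: "integrable M (\<lambda>\<omega>. Z a \<omega> * Z b \<omega>)" for a b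
    unfolding Z_def by (rule integrable_mult_of_squares) (simp_all add: square_product)
  let ?D = "\<lambda>\<omega>. gamma_hat \<xi> n j \<omega> $ \<nu> $ \<mu> - ?\<gamma>"
  have D: "?D \<omega> = (\<Sum>i\<in>?G. Z i \<omega> - ?\<gamma>) / ?N" for \<omega>
    using pos by (simp add: gamma_hat_nth Z_def sum_subtractf field_simps)
  have D2: "(?D \<omega>)\<^sup>2 = (\<Sum>a\<in>?G. \<Sum>b\<in>?G. (Z a \<omega> - ?\<gamma>) * (Z b \<omega> - ?\<gamma>)) / ?N\<^sup>2" for \<omega>
    unfolding D power_divide by (simp add: power2_eq_square sum_product)
  have W: "integrable M (\<lambda>\<omega>. (Z a \<omega> - ?\<gamma>) * (Z b \<omega> - ?\<gamma>))"
    and W': "expectation (\<lambda>\<omega>. (Z a \<omega> - ?\<gamma>) * (Z b \<omega> - ?\<gamma>)) = expectation (\<lambda>\<omega>. Z a \<omega> * Z b \<omega>) - ?\<gamma>\<^sup>2" for a b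
  proof -
    have eq: "(Z a \<omega> - ?\<gamma>) * (Z b \<omega> - ?\<gamma>) = Z a \<omega> * Z b \<omega> - ?\<gamma> * Z a \<omega> - ?\<gamma> * Z b \<omega> + ?\<gamma>\<^sup>2" for \<omega>
      by (simp add: algebra_simps power2_eq_square)
    show "integrable M (\<lambda>\<omega>. (Z a \<omega> - ?\<gamma>) * (Z b \<omega> - ?\<gamma>))"
      unfolding eq using Z1 Z2 by simp
    show "expectation (\<lambda>\<omega>. (Z a \<omega> - ?\<gamma>) * (Z b \<omega> - ?\<gamma>)) = expectation (\<lambda>\<omega>. Z a \<omega> * Z b \<omega>) - ?\<gamma>\<^sup>2"
      unfolding eq using Z1 Z2 by (simp add: prob_space power2_eq_square)
  qed
  have iD2: "integrable M (\<lambda>\<omega>. (?D \<omega>)\<^sup>2)"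
    unfolding D2 by (intro integrable_divide Bochner_Integration.integrable_sum W)
  have inner: "(\<Sum>b\<in>?G. expectation (\<lambda>\<omega>. Z a \<omega> * Z b \<omega>) - ?\<gamma>\<^sup>2) \<le> ?B" for a
  proof -
    have "(\<Sum>b\<in>?G. expectation (\<lambda>\<omega>. Z a \<omega> * Z b \<omega>) - ?\<gamma>\<^sup>2) \<le> (\<Sum>b\<in>?G. 4 * mom4 * sqrt (phi M \<xi> (sup_norm (b - a) - L)))"
      unfolding Z_def by (intro sum_mono order_trans[OF abs_ge_self covariance_products_le[OF assms(1)]])
    also have "\<dots> = 4 * mom4 * (\<Sum>b\<in>?G. sqrt (phi M \<xi> (sup_norm (b - a) - L)))"
      by (simp only: sum_distrib_left)
    also have "(\<Sum>b\<in>?G. sqrt (phi M \<xi> (sup_norm (b - a) - L))) = (\<Sum>d\<in>(\<lambda>b. b - a) ` ?G. sqrt (phi M \<xi> (sup_norm d - L)))"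
      by (subst sum.reindex) (auto simp: inj_on_def)
    also have "4 * mom4 * \<dots> \<le> ?B"
      using fin mom4_nonneg by (intro mult_left_mono sum_sqrt_phi_le) auto
    finally show ?thesis .
  qed
  have "expectation (\<lambda>\<omega>. (?D \<omega>)\<^sup>2) = (\<Sum>a\<in>?G. \<Sum>b\<in>?G. expectation (\<lambda>\<omega>. Z a \<omega> * Z b \<omega>) - ?\<gamma>\<^sup>2) / ?N\<^sup>2"
    unfolding D2 by (simp add: W W' Bochner_Integration.integral_sum Bochner_Integration.integrable_sum)
  also have "\<dots> \<le> (\<Sum>a\<in>?G. ?B) / ?N\<^sup>2"
    by (intro divide_right_mono sum_mono inner) auto
  also have "\<dots> = ?B / ?N" using pos by (simp add: power2_eq_square)
  finally have "expectation (\<lambda>\<omega>. (?D \<omega>)\<^sup>2) \<le> ?B / ?N" .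
  then have "sqrt (expectation (\<lambda>\<omega>. (?D \<omega>)\<^sup>2)) \<le> sqrt (?B / ?N)" by (rule real_sqrt_le_mono)
  moreover have "expectation (\<lambda>\<omega>. \<bar>?D \<omega>\<bar>) \<le> sqrt (expectation (\<lambda>\<omega>. (?D \<omega>)\<^sup>2))"
    by (rule expectation_abs_le_sqrt[OF _ iD2]) measurable
  ultimately show ?thesis by linarith
qed

end

section \<open>Summation over all lags in the box\<close>

lemma vmin_le: "vmin n \<le> n $ k"
  unfolding vmin_def by (intro Min_le) auto

lemma le_vmax: "n $ k \<le> vmax n"
  unfolding vmax_def by (intro Max_ge) auto

lemma lag_box_subset: "lag_box m \<subseteq> {j. sup_norm j \<le> vmax m}"
proof
  fix j assume "j \<in> lag_box m"
  then have "\<bar>j $ k\<bar> \<le> int (vmax m)" for k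
    using le_vmax[of m k] by (auto simp: lag_box_def intro: order_trans)
  then show "j \<in> {j. sup_norm j \<le> vmax m}" by (simp add: sup_norm_le_iff)
qed

lemma finite_lag_box: "finite (lag_box m)"
  by (rule finite_subset[OF lag_box_subset card_cube(1)])

lemma card_lag_box_le: "card (lag_box (m :: nat ^ 'q)) \<le> (2 * vmax m + 1) ^ CARD('q)"
  using card_mono[OF card_cube(1) lag_box_subset[of m]] by (simp add: card_cube)

lemma in_lag_boxI: "sup_norm j \<le> vmin m \<Longrightarrow> j \<in> lag_box m"
  using abs_le_sup_norm[of j] vmin_le[of m] by (auto simp: lag_box_def intro!: order_trans[OF abs_le_sup_norm])
    (metis of_nat_le_iff order_trans)

lemma finite_Gam_lag: "finite (Gam_lag n j)"
  and card_Gam_lag_ge: "sup_norm j \<le> L \<Longrightarrow> (vmin n - L) ^ CARD('q) \<le> card (Gam_lag (n :: nat ^ 'q) j)"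
proof -
  have *: "Gam_lag n j = {i. \<forall>k. i $ k \<in> {max 1 (1 - j $ k)..min (int (n $ k)) (int (n $ k) - j $ k)}}"
    by (auto simp: Gam_lag_def Gam_def) (smt (verit, best))+
  show "finite (Gam_lag n j)"
    unfolding * by (rule card_vec_product) simp
  assume "sup_norm j \<le> L"
  then have j: "\<bar>j $ k\<bar> \<le> int L" for k by (simp add: sup_norm_le_iff)
  have "(vmin n - L) ^ CARD('q) = (\<Prod>k\<in>(UNIV :: 'q set). vmin n - L)" by simp
  also have "\<dots> \<le> (\<Prod>k\<in>UNIV. card {max 1 (1 - j $ k)..min (int (n $ k)) (int (n $ k) - j $ k)})"
  proof (rule prod_mono, safe)
    fix k
    show "vmin n - L \<le> card {max 1 (1 - j $ k)..min (int (n $ k)) (int (n $ k) - j $ k)}"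
      using j[of k] vmin_le[of n k] by simp
  qed
  also have "\<dots> = card (Gam_lag n j)"
    unfolding * by (rule card_vec_product(2)[symmetric]) simp
  finally show "(vmin n - L) ^ CARD('q) \<le> card (Gam_lag n j)" .
qed

lemma filterlim_vmin: "filterlim vmin at_top to_infinity"
  unfolding to_infinity_def by (rule filterlim_filtercomap)

lemma abs_weighted_sum_le:
  fixes a x :: "'i \<Rightarrow> real"
  assumes "\<And>j. \<bar>a j\<bar> \<le> C"
  shows "\<bar>\<Sum>j\<in>A. a j * x j\<bar> \<le> C * (\<Sum>j\<in>A. \<bar>x j\<bar>)"
proof -
  have "\<bar>\<Sum>j\<in>A. a j * x j\<bar> \<le> (\<Sum>j\<in>A. \<bar>a j * x j\<bar>)" by (rule sum_abs)
  also have "\<dots> \<le> (\<Sum>j\<in>A. C * \<bar>x j\<bar>)"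
    by (rule sum_mono) (simp add: abs_mult assms mult_right_mono)
  finally show ?thesis by (simp add: sum_distrib_left)
qed

context mixing_field
begin

text \<open>With \<open>l = vmax m\<close> and \<open>N = vmin n\<close> there are at most \<open>(3 l)\<^bsup>q\<^esup>\<close> lags, and each of them has at least
  \<open>(N / 2)\<^bsup>q\<^esup>\<close> pairs of sites, hence an error of at most a constant times the root of
  \<open>(6 l / (N / 2))\<^bsup>q\<^esup>\<close>. Squaring the first factor under the root produces
  \<open>(9 l\<^sup>2 * 12 l / N)\<^bsup>q\<^esup> = (108 l\<^sup>3 / N)\<^bsup>q\<^esup>\<close>: this is where the cube in the growth condition comes from.\<close>
lemma sum_L1_bound:
  assumes L: "1 \<le> vmax m" "2 * vmax m \<le> vmin n"
  shows "(\<Sum>j\<in>lag_box m. expectation (\<lambda>\<omega>. \<bar>gamma_hat \<xi> n j \<omega> $ \<nu> $ \<mu> - autocov \<nu> \<mu> j\<bar>))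
       \<le> sqrt (4 * mom4 * phi_const * (108 * (real (vmax m) ^ 3 / real (vmin n))) ^ CARD('q))"
proof -
  define l where "l = real (vmax m)"
  define N where "N = real (vmin n)"
  let ?q = "CARD('q)"
  have l: "1 \<le> l" "2 * l \<le> N" using L by (simp_all add: l_def N_def)
  have each: "expectation (\<lambda>\<omega>. \<bar>gamma_hat \<xi> n j \<omega> $ \<nu> $ \<mu> - autocov \<nu> \<mu> j\<bar>)
      \<le> sqrt (4 * mom4 * phi_const * (12 * l / N) ^ ?q)" if "j \<in> lag_box m" for j
  proof -
    have j: "sup_norm j \<le> vmax m" using that lag_box_subset by auto
    have "(N / 2) ^ ?q \<le> real (vmin n - vmax m) ^ ?q"
      using l L by (intro power_mono) (auto simp: l_def N_def of_nat_diff)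
    also have "\<dots> \<le> real (card (Gam_lag n j))"
      using card_Gam_lag_ge[OF j, of n] by (metis of_nat_le_iff of_nat_power)
    finally have N: "(N / 2) ^ ?q \<le> real (card (Gam_lag n j))" .
    have N0: "0 < (N / 2) ^ ?q" using l by (intro zero_less_power) linarith
    then have pos: "0 < card (Gam_lag n j)" using N by (metis of_nat_0_less_iff order_less_le_trans)
    have "expectation (\<lambda>\<omega>. \<bar>gamma_hat \<xi> n j \<omega> $ \<nu> $ \<mu> - autocov \<nu> \<mu> j\<bar>)
        \<le> sqrt (4 * mom4 * ((3 * (1 + l)) ^ ?q * phi_const) / real (card (Gam_lag n j)))"
      unfolding l_def by (rule gamma_hat_L1_bound[OF j finite_Gam_lag pos])
    also have "\<dots> \<le> sqrt (4 * mom4 * ((6 * l) ^ ?q * phi_const) / (N / 2) ^ ?q)"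
      using l N N0 mom4_nonneg phi_const_nonneg
      by (intro real_sqrt_le_mono frac_le mult_left_mono mult_right_mono power_mono mult_nonneg_nonneg) auto
    also have "4 * mom4 * ((6 * l) ^ ?q * phi_const) / (N / 2) ^ ?q = 4 * mom4 * phi_const * ((6 * l) / (N / 2)) ^ ?q"
    proof -
      have "a * (b * c) / d = a * c * (b / d)" for a b c d :: real by simp
      from this[of "4 * mom4" "(6 * l) ^ ?q" phi_const "(N / 2) ^ ?q"] show ?thesis
        by (simp only: power_divide[of "6 * l" "N / 2"])
    qed
    also have "(6 * l) / (N / 2) = 12 * l / N" by simp
    finally show ?thesis .
  qed
  have "(\<Sum>j\<in>lag_box m. expectation (\<lambda>\<omega>. \<bar>gamma_hat \<xi> n j \<omega> $ \<nu> $ \<mu> - autocov \<nu> \<mu> j\<bar>))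
      \<le> real (card (lag_box m)) * sqrt (4 * mom4 * phi_const * (12 * l / N) ^ ?q)"
    using sum_bounded_above[of "lag_box m", OF each] by simp
  also have "\<dots> \<le> (3 * l) ^ ?q * sqrt (4 * mom4 * phi_const * (12 * l / N) ^ ?q)"
  proof (intro mult_right_mono)
    have "real (card (lag_box m)) \<le> real ((2 * vmax m + 1) ^ ?q)"
      using card_lag_box_le[of m] by (simp only: of_nat_le_iff)
    also have "\<dots> = (2 * l + 1) ^ ?q" by (simp add: l_def add.commute)
    also have "\<dots> \<le> (3 * l) ^ ?q" using l by (intro power_mono) auto
    finally show "real (card (lag_box m)) \<le> (3 * l) ^ ?q" .
  qed (use l mom4_nonneg phi_const_nonneg in auto)
  also have "\<dots> = sqrt (((3 * l) ^ ?q)\<^sup>2 * (4 * mom4 * phi_const * (12 * l / N) ^ ?q))"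
    using l by (simp add: real_sqrt_mult)
  also have "((3 * l) ^ ?q)\<^sup>2 * (4 * mom4 * phi_const * (12 * l / N) ^ ?q)
      = 4 * mom4 * phi_const * ((3 * l)\<^sup>2 * (12 * l / N)) ^ ?q"
  proof -
    have "((3 * l) ^ ?q)\<^sup>2 = ((3 * l)\<^sup>2) ^ ?q"
      by (simp only: power_mult[symmetric] mult.commute)
    then show ?thesis
      by (simp only: power_mult_distrib[of "(3 * l)\<^sup>2" "12 * l / N"] mult.left_commute)
  qed
  also have "(3 * l)\<^sup>2 * (12 * l / N) = 108 * (l ^ 3 / N)"
    by (simp add: power2_eq_square power3_eq_cube)
  finally show ?thesis by (simp add: l_def N_def)
qed

lemma sum_L1_tendsto:
  fixes m :: "nat ^ 'q \<Rightarrow> nat ^ 'q"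
  assumes minf: "filterlim m to_infinity to_infinity"
    and rate: "((\<lambda>n. real (vmax (m n)) ^ 3 / real (vmin n)) \<longlongrightarrow> 0) to_infinity"
  shows "((\<lambda>n. \<Sum>j\<in>lag_box (m n). expectation (\<lambda>\<omega>. \<bar>gamma_hat \<xi> n j \<omega> $ \<nu> $ \<mu> - autocov \<nu> \<mu> j\<bar>)) \<longlongrightarrow> 0) to_infinity"
proof (rule tendsto_sandwich[where f="\<lambda>_. 0"])
  have "\<forall>\<^sub>F n in to_infinity. 1 \<le> vmin (m n)"
    using filterlim_compose[OF filterlim_vmin minf] by (simp add: filterlim_at_top)
  moreover have "\<forall>\<^sub>F n in to_infinity. 1 \<le> vmin (n :: nat ^ 'q)"
    by (rule filterlim_vmin[unfolded filterlim_at_top, rule_format])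
  moreover have "\<forall>\<^sub>F n in to_infinity. real (vmax (m n)) ^ 3 / real (vmin n) < 1 / 2"
    using order_tendstoD(2)[OF rate, of "1/2"] by simp
  ultimately show "\<forall>\<^sub>F n in to_infinity. (\<Sum>j\<in>lag_box (m n). expectation (\<lambda>\<omega>. \<bar>gamma_hat \<xi> n j \<omega> $ \<nu> $ \<mu> - autocov \<nu> \<mu> j\<bar>))
      \<le> sqrt (4 * mom4 * phi_const * (108 * (real (vmax (m n)) ^ 3 / real (vmin n))) ^ CARD('q))"
  proof eventually_elim
    case (elim n)
    have 1: "1 \<le> vmax (m n)"
      using elim(1) vmin_le[of "m n" undefined] le_vmax[of "m n" undefined] by linarith
    have "real (vmax (m n)) ^ 1 \<le> real (vmax (m n)) ^ 3"
      using 1 by (intro power_increasing) auto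
    also have "\<dots> < real (vmin n) / 2" using elim by (simp add: field_simps)
    finally have "2 * vmax (m n) \<le> vmin n" by simp
    from sum_L1_bound[OF 1 this] show ?case .
  qed
  have "((\<lambda>n. sqrt (4 * mom4 * phi_const * (108 * (real (vmax (m n)) ^ 3 / real (vmin n))) ^ CARD('q))) \<longlongrightarrow>
      sqrt (4 * mom4 * phi_const * (108 * 0) ^ CARD('q))) to_infinity"
    by (intro tendsto_intros rate)
  then show "((\<lambda>n. sqrt (4 * mom4 * phi_const * (108 * (real (vmax (m n)) ^ 3 / real (vmin n))) ^ CARD('q))) \<longlongrightarrow> 0) to_infinity"
    by (simp add: zero_power)
qed (auto intro!: always_eventually sum_nonneg)

text \<open>Replacing the estimated by the true autocovariances costs at most \<open>C\<close> times the total error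
  of the previous lemma, since the threshold factor \<open>U\<close> lies in the unit interval. With the true
  autocovariances this is a dominated convergence argument for sums: a finite set \<open>F\<close> carries
  almost all of the absolute series, every lag in \<open>F\<close> eventually lies in the box, and there
  \<open>E \<bar>W U - 1\<bar> \<le> \<bar>W - 1\<bar> + (1 - E U)\<close> vanishes. The last estimate uses \<open>U \<le> 1\<close>, which turns
  convergence of the means of \<open>U\<close> into convergence in mean.\<close>
lemma thresholded_entry_L1:
  fixes m :: "nat ^ 'q \<Rightarrow> nat ^ 'q" and W :: "nat ^ 'q \<Rightarrow> int ^ 'q \<Rightarrow> real"
    and U :: "nat ^ 'q \<Rightarrow> int ^ 'q \<Rightarrow> 'w \<Rightarrow> real" and \<nu> \<mu> :: 'p
  assumes minf: "filterlim m to_infinity to_infinity"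
    and rate: "((\<lambda>n. real (vmax (m n)) ^ 3 / real (vmin n)) \<longlongrightarrow> 0) to_infinity"
    and W: "\<And>j. ((\<lambda>n. W n j) \<longlongrightarrow> 1) to_infinity" and WC: "\<And>n j. \<bar>W n j\<bar> \<le> C"
    and U[measurable]: "\<And>n j. U n j \<in> borel_measurable M"
    and U01: "\<And>n j \<omega>. 0 \<le> U n j \<omega>" "\<And>n j \<omega>. U n j \<omega> \<le> 1"
    and EU: "\<And>j. ((\<lambda>n. expectation (U n j)) \<longlongrightarrow> 1) to_infinity"
  defines "T \<equiv> \<lambda>n \<omega>. \<Sum>j\<in>lag_box (m n). W n j * (gamma_hat \<xi> n j \<omega> $ \<nu> $ \<mu> * U n j \<omega>)"
  shows "integrable M (T n)"
    and "((\<lambda>n. expectation (\<lambda>\<omega>. \<bar>T n \<omega> - (\<Sum>\<^sub>\<infinity>k\<in>UNIV. autocov \<nu> \<mu> k)\<bar>)) \<longlongrightarrow> 0) to_infinity"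
proof -
  let ?\<gamma> = "autocov \<nu> \<mu>"
  let ?h = "\<lambda>n j \<omega>. gamma_hat \<xi> n j \<omega> $ \<nu> $ \<mu>"
  define \<sigma> where "\<sigma> = (\<Sum>\<^sub>\<infinity>k\<in>UNIV. ?\<gamma> k)"
  define \<tau> where "\<tau> = (\<Sum>\<^sub>\<infinity>k\<in>UNIV. \<bar>?\<gamma> k\<bar>)"
  define S where "S n = (\<Sum>j\<in>lag_box (m n). expectation (\<lambda>\<omega>. \<bar>?h n j \<omega> - ?\<gamma> j\<bar>))" for n
  have C: "0 \<le> C" using WC[of undefined undefined] by linarith
  have iU: "integrable M (U n j)" for n j
    by (rule integrable_const_bound[of _ 1]) (use U01 in auto)
  have iT: "integrable M (T n)" for n
    unfolding T_def
  proof (intro Bochner_Integration.integrable_sum integrable_mult_right)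
    fix j
    show "integrable M (\<lambda>\<omega>. ?h n j \<omega> * U n j \<omega>)"
      by (rule Bochner_Integration.integrable_bound[OF gamma_hat_integrable[of n j \<nu> \<mu>]])
         (simp_all add: abs_mult U01 mult_right_le_one_le)
  qed
  then show "integrable M (T n)" .
  show "((\<lambda>n. expectation (\<lambda>\<omega>. \<bar>T n \<omega> - \<sigma>\<bar>)) \<longlongrightarrow> 0) to_infinity"
  proof (rule tendstoI)
    fix e :: real assume e: "0 < e"
    \<comment> \<open>The tail of the series outside \<open>F\<close> enters once with weight \<open>C\<close> and once with weight 1.\<close>
    define d where "d = e / (2 * (C + 1))"
    have d: "0 < d" "(C + 1) * d = e / 2" using e C by (auto simp: d_def field_simps)
    have "(?\<gamma> has_sum \<sigma>) UNIV" "((\<lambda>k. \<bar>?\<gamma> k\<bar>) has_sum \<tau>) UNIV"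
      using autocov_summable[of \<nu> \<mu>] Infinite_Sum.abs_summable_summable[OF autocov_summable[of \<nu> \<mu>]]
      by (auto simp: \<sigma>_def \<tau>_def)
    then have "\<forall>\<^sub>F F in finite_subsets_at_top UNIV. dist (sum ?\<gamma> F) \<sigma> < d \<and> dist (\<Sum>k\<in>F. \<bar>?\<gamma> k\<bar>) \<tau> < d"
      unfolding has_sum_def using d by (intro eventually_conj tendstoD)
    then obtain F where F: "finite F" "dist (sum ?\<gamma> F) \<sigma> < d" "dist (\<Sum>k\<in>F. \<bar>?\<gamma> k\<bar>) \<tau> < d"
      unfolding eventually_finite_subsets_at_top by blast
    define R where "R n = C * S n + (\<Sum>j\<in>F. \<bar>?\<gamma> j\<bar> * (\<bar>W n j - 1\<bar> + (1 - expectation (U n j))))" for n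
    have "(R \<longlongrightarrow> C * 0 + (\<Sum>j\<in>F. \<bar>?\<gamma> j\<bar> * (\<bar>1 - 1\<bar> + (1 - 1)))) to_infinity"
      unfolding R_def S_def by (intro tendsto_intros sum_L1_tendsto minf rate W EU)
    then have R: "\<forall>\<^sub>F n in to_infinity. R n < e / 2"
      using e by (intro order_tendstoD(2)) auto
    have "\<forall>\<^sub>F n in to_infinity. j \<in> lag_box (m n)" for j
    proof -
      have "\<forall>\<^sub>F n in to_infinity. sup_norm j \<le> vmin (m n)"
        using filterlim_compose[OF filterlim_vmin minf] by (simp add: filterlim_at_top)
      then show ?thesis by eventually_elim (rule in_lag_boxI)
    qed
    then have "\<forall>\<^sub>F n in to_infinity. \<forall>j\<in>F. j \<in> lag_box (m n)"
      using F(1) by (intro eventually_ball_finite) auto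
    with R show "\<forall>\<^sub>F n in to_infinity. dist (expectation (\<lambda>\<omega>. \<bar>T n \<omega> - \<sigma>\<bar>)) 0 < e"
    proof eventually_elim
      case (elim n)
      let ?B = "lag_box (m n)"
      have FB: "F \<subseteq> ?B" using elim by auto
      have fB: "finite ?B" by (rule finite_lag_box)
      define P where "P \<omega> = C * (\<Sum>j\<in>?B. \<bar>?h n j \<omega> - ?\<gamma> j\<bar>)
        + (\<Sum>j\<in>F. \<bar>?\<gamma> j\<bar> * (\<bar>W n j - 1\<bar> + (1 - U n j \<omega>))) + (C + 1) * d" for \<omega>
      have WU: "\<bar>W n j * U n j \<omega>\<bar> \<le> C" for j \<omega>
        using mult_mono[OF WC[of n j] U01(2)[of n j \<omega>]] C U01(1)[of n j \<omega>] by (simp add: abs_mult)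
      have pw: "\<bar>T n \<omega> - \<sigma>\<bar> \<le> P \<omega>" for \<omega>
      proof -
        have sp: "(\<Sum>j\<in>?B. f j) = (\<Sum>j\<in>F. f j) + (\<Sum>j\<in>?B - F. f j)" for f :: "_ \<Rightarrow> real"
          by (subst sum.subset_diff[OF FB fB]) simp
        have "T n \<omega> = (\<Sum>j\<in>?B. W n j * U n j \<omega> * (?h n j \<omega> - ?\<gamma> j)) + (\<Sum>j\<in>?B. W n j * U n j \<omega> * ?\<gamma> j)"
          unfolding T_def by (simp add: sum.distrib[symmetric] algebra_simps)
        also have "(\<Sum>j\<in>?B. W n j * U n j \<omega> * ?\<gamma> j)
            = (\<Sum>j\<in>F. (W n j * U n j \<omega> - 1) * ?\<gamma> j) + (\<Sum>j\<in>F. ?\<gamma> j) + (\<Sum>j\<in>?B - F. W n j * U n j \<omega> * ?\<gamma> j)"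
          unfolding sp[of "\<lambda>j. W n j * U n j \<omega> * ?\<gamma> j"] by (simp add: sum.distrib[symmetric] algebra_simps)
        finally have Teq: "T n \<omega> - \<sigma> = (\<Sum>j\<in>?B. W n j * U n j \<omega> * (?h n j \<omega> - ?\<gamma> j))
            + (\<Sum>j\<in>F. (W n j * U n j \<omega> - 1) * ?\<gamma> j) + (\<Sum>j\<in>?B - F. W n j * U n j \<omega> * ?\<gamma> j) + (sum ?\<gamma> F - \<sigma>)"
          by simp
        have a1: "\<bar>\<Sum>j\<in>?B. W n j * U n j \<omega> * (?h n j \<omega> - ?\<gamma> j)\<bar> \<le> C * (\<Sum>j\<in>?B. \<bar>?h n j \<omega> - ?\<gamma> j\<bar>)"
          by (rule abs_weighted_sum_le[OF WU])
        have a2: "\<bar>\<Sum>j\<in>F. (W n j * U n j \<omega> - 1) * ?\<gamma> j\<bar> \<le> (\<Sum>j\<in>F. \<bar>?\<gamma> j\<bar> * (\<bar>W n j - 1\<bar> + (1 - U n j \<omega>)))"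
        proof (rule order_trans[OF sum_abs], intro sum_mono)
          fix j
          have "W n j * U n j \<omega> - 1 = (W n j - 1) * U n j \<omega> - (1 - U n j \<omega>)" by (simp add: algebra_simps)
          also have "\<bar>\<dots>\<bar> \<le> \<bar>(W n j - 1) * U n j \<omega>\<bar> + \<bar>1 - U n j \<omega>\<bar>" by (rule abs_triangle_ineq4)
          also have "\<dots> \<le> \<bar>W n j - 1\<bar> + (1 - U n j \<omega>)"
            using U01(1)[of n j \<omega>] U01(2)[of n j \<omega>] by (simp add: abs_mult mult_left_le)
          finally have "\<bar>W n j * U n j \<omega> - 1\<bar> * \<bar>?\<gamma> j\<bar> \<le> (\<bar>W n j - 1\<bar> + (1 - U n j \<omega>)) * \<bar>?\<gamma> j\<bar>"
            by (intro mult_right_mono) auto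
          then show "\<bar>(W n j * U n j \<omega> - 1) * ?\<gamma> j\<bar> \<le> \<bar>?\<gamma> j\<bar> * (\<bar>W n j - 1\<bar> + (1 - U n j \<omega>))"
            by (simp add: abs_mult mult.commute)
        qed
        have "\<bar>\<Sum>j\<in>?B - F. W n j * U n j \<omega> * ?\<gamma> j\<bar> \<le> C * (\<Sum>j\<in>?B - F. \<bar>?\<gamma> j\<bar>)"
          by (rule abs_weighted_sum_le[OF WU])
        also have "(\<Sum>j\<in>?B - F. \<bar>?\<gamma> j\<bar>) \<le> d"
        proof -
          have "(\<Sum>j\<in>?B. \<bar>?\<gamma> j\<bar>) \<le> \<tau>"
            unfolding \<tau>_def using autocov_summable[of \<nu> \<mu>] fB by (intro finite_sum_le_infsum) auto
          then show ?thesis using sp[of "\<lambda>j. \<bar>?\<gamma> j\<bar>"] F(3) by (simp add: dist_real_def)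
        qed
        finally have a3: "\<bar>\<Sum>j\<in>?B - F. W n j * U n j \<omega> * ?\<gamma> j\<bar> \<le> C * d"
          using C by (simp add: mult_left_mono)
        have a4: "\<bar>sum ?\<gamma> F - \<sigma>\<bar> \<le> d" using F(2) by (simp add: dist_real_def)
        have "(C + 1) * d = C * d + d" by (simp add: algebra_simps)
        then show ?thesis
          unfolding Teq P_def using a1 a2 a3 a4 by linarith
      qed
      have ih: "integrable M (\<lambda>\<omega>. \<bar>?h n j \<omega> - ?\<gamma> j\<bar>)" for j
        using gamma_hat_integrable by auto
      have iP: "integrable M P"
        unfolding P_def
        by (intro Bochner_Integration.integrable_add integrable_mult_right Bochner_Integration.integrable_sum ih
            Bochner_Integration.integrable_diff iU) auto
      have "expectation (\<lambda>\<omega>. \<bar>T n \<omega> - \<sigma>\<bar>) \<le> expectation P"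
        by (rule integral_mono[OF _ iP pw]) (use iT in auto)
      also have "expectation P = R n + (C + 1) * d"
        unfolding P_def R_def S_def using ih iU
        by (simp add: Bochner_Integration.integral_sum prob_space Bochner_Integration.integrable_sum)
      also have "\<dots> < e" using elim(1) d by simp
      finally have "expectation (\<lambda>\<omega>. \<bar>T n \<omega> - \<sigma>\<bar>) < e" .
      moreover have "0 \<le> expectation (\<lambda>\<omega>. \<bar>T n \<omega> - \<sigma>\<bar>)" by simp
      ultimately show ?case by (simp add: dist_real_def)
    qed
  qed
qed

end

section \<open>Consistency in the maximum norm\<close>

lemma max_norm_nonneg: "0 \<le> max_norm A"
  and max_norm_le: "max_norm A \<le> (\<Sum>\<nu>\<in>UNIV. \<Sum>\<mu>\<in>UNIV. \<bar>A $ \<nu> $ \<mu>\<bar>)"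
proof -
  let ?S = "{\<bar>A $ \<nu> $ \<mu>\<bar> | \<nu> \<mu>. True}"
  have "?S = (\<lambda>(\<nu>, \<mu>). \<bar>A $ \<nu> $ \<mu>\<bar>) ` UNIV" by auto
  then have fin: "finite ?S" "?S \<noteq> {}" by auto
  then obtain \<nu> \<mu> where *: "max_norm A = \<bar>A $ \<nu> $ \<mu>\<bar>"
    using Max_in[of ?S] unfolding max_norm_def by auto
  then show "0 \<le> max_norm A" by simp
  have "\<bar>A $ \<nu> $ \<mu>\<bar> \<le> (\<Sum>\<mu>\<in>UNIV. \<bar>A $ \<nu> $ \<mu>\<bar>)" by (rule member_le_sum) auto
  also have "\<dots> \<le> (\<Sum>\<nu>\<in>UNIV. \<Sum>\<mu>\<in>UNIV. \<bar>A $ \<nu> $ \<mu>\<bar>)"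
    by (rule member_le_sum) (auto intro: sum_nonneg)
  finally show "max_norm A \<le> (\<Sum>\<nu>\<in>UNIV. \<Sum>\<mu>\<in>UNIV. \<bar>A $ \<nu> $ \<mu>\<bar>)" using * by simp
qed

text \<open>Domination by the measurable \<open>Y n\<close> takes the place of a measurability proof for the maximum
  norm: a set that is not measurable has measure zero by convention.\<close>
lemma (in prob_space) tends_to_zero_in_prob_if_L1:
  assumes le: "\<And>n \<omega>. \<omega> \<in> space M \<Longrightarrow> \<bar>X n \<omega>\<bar> \<le> Y n \<omega>" and i: "\<And>n. integrable M (Y n)"
    and lim: "((\<lambda>n. expectation (Y n)) \<longlongrightarrow> 0) F"
  shows "tends_to_zero_in_prob M X F"
  unfolding tends_to_zero_in_prob_def
proof (intro allI impI)
  fix e :: real assume e: "e > 0"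
  have Markov: "\<P>(\<omega> in M. \<bar>X n \<omega>\<bar> > e) \<le> expectation (Y n) / e" for n
  proof -
    have [measurable]: "Y n \<in> borel_measurable M" by (rule borel_measurable_integrable[OF i])
    have sub: "{\<omega> \<in> space M. e < \<bar>X n \<omega>\<bar>} \<subseteq> {\<omega> \<in> space M. e \<le> Y n \<omega>}"
    proof
      fix \<omega> assume "\<omega> \<in> {\<omega> \<in> space M. e < \<bar>X n \<omega>\<bar>}"
      then have "\<omega> \<in> space M" "e < \<bar>X n \<omega>\<bar>" by simp_all
      moreover from le[OF this(1), of n] this(2) have "e \<le> Y n \<omega>" by linarith
      ultimately show "\<omega> \<in> {\<omega> \<in> space M. e \<le> Y n \<omega>}" by simp
    qed
    have "\<P>(\<omega> in M. \<bar>X n \<omega>\<bar> > e) \<le> \<P>(\<omega> in M. Y n \<omega> \<ge> e)"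
      by (rule finite_measure_mono[OF sub]) measurable
    also have "\<dots> \<le> expectation (Y n) / e"
    proof (rule integral_Markov_inequality_measure[OF i sets.empty_sets _ e])
      have "0 \<le> Y n \<omega>" if "\<omega> \<in> space M" for \<omega>
        using le[OF that, of n] abs_ge_zero[of "X n \<omega>"] by linarith
      then show "AE \<omega> in M. 0 \<le> Y n \<omega>" by (rule AE_I2)
    qed
    finally show ?thesis .
  qed
  have "((\<lambda>n. expectation (Y n) / e) \<longlongrightarrow> 0 / e) F"
    by (rule tendsto_divide[OF lim tendsto_const]) (use e in simp)
  then have lim': "((\<lambda>n. expectation (Y n) / e) \<longlongrightarrow> 0) F" by simp
  show "((\<lambda>n. \<P>(\<omega> in M. \<bar>X n \<omega>\<bar> > e)) \<longlongrightarrow> 0) F"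
    by (rule tendsto_sandwich[OF always_eventually always_eventually tendsto_const lim'])
       (simp_all add: Markov)
qed

theorem theorem3p2:
  fixes M :: "'w measure"
    and \<xi> :: "int ^ 'q \<Rightarrow> 'w \<Rightarrow> real ^ 'p"
    and w :: "nat ^ 'q \<Rightarrow> int ^ 'q \<Rightarrow> real"
    and C\<^sub>w :: real
    and m :: "nat ^ 'q \<Rightarrow> nat ^ 'q"
    and g :: "real \<Rightarrow> real \<Rightarrow> real"
    and c :: "nat ^ 'q \<Rightarrow> int ^ 'q \<Rightarrow> real"
  assumes "prob_space M"
    and "\<And>i. \<xi> i \<in> borel_measurable M"
    and "strictly_stationary M \<xi>"
    and "phi_mixing M \<xi>"
    and "(\<integral>\<omega>. \<xi> 0 \<omega> \<partial>M) = 0"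
    and "\<And>\<nu>. integrable M (\<lambda>\<omega>. (\<xi> 0 \<omega> $ \<nu>) ^ 4)"
    and "summable (\<lambda>r. real (Suc r) ^ (CARD('q) - 1) * sqrt (phi M \<xi> (Suc r)))"
    and "\<And>j. ((\<lambda>m'. w m' j) \<longlongrightarrow> 1) to_infinity"
    and "\<And>m' j. \<bar>w m' j\<bar> \<le> C\<^sub>w"
    and "filterlim m to_infinity to_infinity"
    and "((\<lambda>n. real (vmax (m n)) ^ 3 / real (vmin n)) \<longlongrightarrow> 0) to_infinity"
    and "(\<lambda>(a, t). g a t) \<in> borel_measurable (restrict_space borel (UNIV \<times> {0..}))"
    and "\<And>a t. t \<ge> 0 \<Longrightarrow> g a t \<in> {0..1}"
    and "\<And>n j. c n j \<ge> 0"
    and "\<And>j \<nu> \<mu>. ((\<lambda>n. \<integral>\<omega>. g (gamma_hat \<xi> n j \<omega> $ \<nu> $ \<mu>) (c n j) \<partial>M) \<longlongrightarrow> 1) to_infinity"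
  shows "tends_to_zero_in_prob M
           (\<lambda>n \<omega>. max_norm (sigma_hat_th \<xi> w m g c n \<omega> - asym_var M \<xi>)) to_infinity"
proof -
  interpret prob_space M by fact
  interpret mixing_field M \<xi>
    by unfold_locales (use assms in auto)
  have g: "(\<lambda>a. g a t) \<in> borel_measurable borel" if "0 \<le> t" for t
  proof -
    have "(\<lambda>a :: real. (a, t)) \<in> measurable borel (restrict_space borel (UNIV \<times> {0..}))"
      using that by (intro measurable_restrict_space2) auto
    from measurable_compose[OF this assms(12)] show ?thesis by simp
  qed
  define U where "U \<nu> \<mu> n j \<omega> = g (gamma_hat \<xi> n j \<omega> $ \<nu> $ \<mu>) (c n j)" for \<nu> \<mu> n j \<omega>
  have U: "U \<nu> \<mu> n j \<in> borel_measurable M" for \<nu> \<mu> n j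
    unfolding U_def[abs_def] by (rule measurable_compose[OF gamma_hat_measurable g[OF assms(14)]])
  have U01: "0 \<le> U \<nu> \<mu> n j \<omega>" "U \<nu> \<mu> n j \<omega> \<le> 1" for \<nu> \<mu> n j \<omega>
    using assms(13)[OF assms(14)] by (auto simp: U_def)
  have EU: "((\<lambda>n. expectation (U \<nu> \<mu> n j)) \<longlongrightarrow> 1) to_infinity" for \<nu> \<mu> j
    using assms(15) by (simp add: U_def[abs_def])
  have W: "((\<lambda>n. w (m n) j) \<longlongrightarrow> 1) to_infinity" for j
    by (rule filterlim_compose[OF assms(8) assms(10)])
  note entry = thresholded_entry_L1[where W="\<lambda>n. w (m n)", OF assms(10,11) W assms(9) U U01 EU]
  have nth: "(sigma_hat_th \<xi> w m g c n \<omega> - asym_var M \<xi>) $ \<nu> $ \<mu>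
    = (\<Sum>j\<in>lag_box (m n). w (m n) j * (gamma_hat \<xi> n j \<omega> $ \<nu> $ \<mu> * U \<nu> \<mu> n j \<omega>)) - (\<Sum>\<^sub>\<infinity>k\<in>UNIV. autocov \<nu> \<mu> k)"
    for n \<omega> \<nu> \<mu>
    by (simp add: asym_var_nth sigma_hat_th_def hadamard_def entrywise_def U_def)
  let ?A = "\<lambda>n \<omega>. sigma_hat_th \<xi> w m g c n \<omega> - asym_var M \<xi>"
  have i: "integrable M (\<lambda>\<omega>. \<bar>?A n \<omega> $ \<nu> $ \<mu>\<bar>)" for n \<nu> \<mu>
    unfolding nth by (intro integrable_abs Bochner_Integration.integrable_diff entry(1)) simp
  have lim: "((\<lambda>n. expectation (\<lambda>\<omega>. \<bar>?A n \<omega> $ \<nu> $ \<mu>\<bar>)) \<longlongrightarrow> 0) to_infinity" for \<nu> \<mu>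
    unfolding nth by (rule entry(2))
  show ?thesis
  proof (rule tends_to_zero_in_prob_if_L1)
    show "\<bar>max_norm (?A n \<omega>)\<bar> \<le> (\<Sum>\<nu>\<in>UNIV. \<Sum>\<mu>\<in>UNIV. \<bar>?A n \<omega> $ \<nu> $ \<mu>\<bar>)" for n \<omega>
      using max_norm_nonneg[of "?A n \<omega>"] max_norm_le[of "?A n \<omega>"] by simp
    show "integrable M (\<lambda>\<omega>. \<Sum>\<nu>\<in>UNIV. \<Sum>\<mu>\<in>UNIV. \<bar>?A n \<omega> $ \<nu> $ \<mu>\<bar>)" for n
      by (intro Bochner_Integration.integrable_sum i)
    have "((\<lambda>n. \<Sum>\<nu>\<in>UNIV. \<Sum>\<mu>\<in>UNIV. expectation (\<lambda>\<omega>. \<bar>?A n \<omega> $ \<nu> $ \<mu>\<bar>)) \<longlongrightarrow> (\<Sum>\<nu>\<in>(UNIV :: 'p set). \<Sum>\<mu>\<in>(UNIV :: 'p set). 0)) to_infinity"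
      by (intro tendsto_sum lim)
    then show "((\<lambda>n. expectation (\<lambda>\<omega>. \<Sum>\<nu>\<in>UNIV. \<Sum>\<mu>\<in>UNIV. \<bar>?A n \<omega> $ \<nu> $ \<mu>\<bar>)) \<longlongrightarrow> 0) to_infinity"
      by (simp add: Bochner_Integration.integral_sum Bochner_Integration.integrable_sum i del: vector_minus_component)
  qed
qed

end
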